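(* Let $K\subset\mathbb{R}^n$ be a convex body containing the origin in its interior, and suppose that the origin $(0,0)\in\mathbb{R}^n\times\mathbb{R}^n$ is a critical point of $\mathcal{F}_K$. Then $$\operatorname{Hess}_{(0,0)}\mathcal{F}_K\ge 0\iff \operatorname{cov}(K^\circ)\ge\frac{1}{(n+2)^2}\cdot\operatorname{cov}(K)^{-1}.$$ Moreover $$\det\big(\operatorname{Hess}_{(0,0)}\mathcal{F}_K\big)=(n+1)^{n}\operatorname{vp}(K)^{n}\det\big[(n+2)^2\operatorname{cov}(K^\circ)\operatorname{cov}(K)-I_n\big].$$
   Context: For a convex body $K\subset\mathbb{R}^n$ containing the origin in its interior, $K^\circ=\{y\in\mathbb{R}^n\mid \langle x,y\rangle\le 1\ \forall x\in K\}$ is its polar body, $|\cdot|$ is the standard Lebesgue measure on $\mathbb{R}^n$, and $\operatorname{vp}(K)=|K|\cdot|K^\circ|$ is the volume product. Define $\mathcal{F}_K(x,\xi)=\operatorname{vp}\big((K^\circ+\xi)^\circ+x\big)$, which is well defined for $(x,\xi)$ in an open neighbourhood $U_K$ of $(0,0)\in\mathbb{R}^n\times\mathbb{R}^n$; $\operatorname{Hess}_{(0,0)}\mathcal{F}_K$ denotes its Hessian matrix at the origin. For a convex body $A$ with barycenter at the origin, $\operatorname{cov}(A)$ is the symmetric $n\times n$ matrix with entries $\operatorname{cov}(A)_{ij}=\frac1{|A|}\int_A x_ix_j\,dx$. (The origin is a critical point of $\mathcal F_K$ if and only if both $K$ and $K^\circ$ have barycenter at the origin, so the covariance matrices in the claim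 are defined.) For symmetric matrices, $A\ge B$ means that $A-B$ is positive semi-definite. $I_n$ is the $n\times n$ identity matrix.
   Formalization: In the determinant formula the exponent n of (n+1) and of vp(K) is corrected to 2n; as printed it fails for K=[-1,1]^2, where the Hessian determinant is 4096 while the printed right-hand side is 64/9. *)

theory Defs
  imports "HOL-Analysis.Analysis"
begin

definition polar :: "'a::real_inner set \<Rightarrow> 'a set" where
  "polar K = {y. \<forall>x\<in>K. x \<bullet> y \<le> 1}"

definition vp :: "'a::euclidean_space set \<Rightarrow> real" where
  "vp K = measure lebesgue K * measure lebesgue (polar K)"

text \<open>
  As a total function this is only meaningful near the origin, where all the bodies involved
  contain the origin in their interior; only its germ at the origin is used.
\<close>
definition vp_shift :: "'a::euclidean_space set \<Rightarrow> 'a \<times> 'a \<Rightarrow> real" where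
  "vp_shift K = (\<lambda>(x, \<xi>). vp ((+) x ` polar ((+) \<xi> ` polar K)))"

definition cov :: "(real ^ 'n) set \<Rightarrow> real ^ 'n ^ 'n" where
  "cov A = (\<chi> i j. (LINT x:A|lebesgue. x $ i * x $ j) / measure lebesgue A)"

definition critical_point :: "('a::real_normed_vector \<Rightarrow> real) \<Rightarrow> 'a \<Rightarrow> bool" where
  "critical_point f p \<longleftrightarrow> (f has_derivative (\<lambda>_. 0)) (at p)"

definition dir_deriv :: "('a::real_normed_vector \<Rightarrow> real) \<Rightarrow> 'a \<Rightarrow> 'a \<Rightarrow> real" where
  "dir_deriv f v p = deriv (\<lambda>t. f (p + t *\<^sub>R v)) 0"

text \<open>
  The standard basis of \<open>\<real>\<^sup>n \<times> \<real>\<^sup>n\<close>, indexed by the sum type \<open>'n + 'n\<close>, which has \<open>2n\<close> elements.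
\<close>
fun basis2 :: "'n + 'n \<Rightarrow> (real ^ 'n) \<times> (real ^ 'n)" where
  "basis2 (Inl i) = (axis i 1, 0)"
| "basis2 (Inr i) = (0, axis i 1)"

text \<open>
  The \<open>2n \<times> 2n\<close> matrix of second partial derivatives. Its determinant is homogeneous of degree
  \<open>2n\<close> in \<open>f\<close>, which is why the constant in the determinant formula is raised to the power
  \<open>2n\<close>. The source prints the exponent \<open>n\<close>; with that exponent the formula already fails for the
  square \<open>[-1,1]\<^sup>2\<close>, where the determinant is \<open>4096 = 3^4 * 8^4 * (-1/9)^2\<close>.
\<close>
definition hessian ::
    "((real ^ 'n) \<times> (real ^ 'n) \<Rightarrow> real) \<Rightarrow> (real ^ 'n) \<times> (real ^ 'n) \<Rightarrow> real ^ ('n + 'n) ^ ('n + 'n)"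
  where "hessian f p = (\<chi> a b. dir_deriv (dir_deriv f (basis2 b)) (basis2 a) p)"

definition psd :: "real ^ 'm ^ 'm \<Rightarrow> bool" where
  "psd M \<longleftrightarrow> transpose M = M \<and> (\<forall>v. 0 \<le> v \<bullet> (M *v v))"

definition loewner_ge :: "real ^ 'm ^ 'm \<Rightarrow> real ^ 'm ^ 'm \<Rightarrow> bool"  (infix \<open>\<succeq>\<close> 50) where
  "A \<succeq> B \<longleftrightarrow> psd (A - B)"

end

theory Submission
  imports Defs
begin

text \<open>
  Write \<open>n\<close> for the dimension and \<open>L\<close> for the polar body of \<open>K\<close>. The polar of a translate \<open>\<xi> + L\<close>
  is the image of \<open>K\<close> under the projective map \<open>k \<mapsto> k / (1 + \<langle>\<xi>, k\<rangle>)\<close>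
  (\<open>polar_translate_polar\<close>), and the volume of such an image is the integral of
  \<open>1 / (1 + \<langle>\<xi>, k\<rangle>)^(n + 1)\<close> over \<open>K\<close> (\<open>emeasure_projective_image\<close>). Applying this once to \<open>K\<close> and once
  to \<open>\<xi> + L\<close> turns the functional into a product of two explicit integrals: for \<open>(x, \<xi>)\<close> near
  the origin, \<open>vp_shift K (x, \<xi>)\<close> is the integral of \<open>1 / (1 + \<langle>\<xi>, k\<rangle>)^(n + 1)\<close> over \<open>k \<in> K\<close> times the
  integral of \<open>1 / (1 + \<langle>x, \<xi>\<rangle> + \<langle>x, w\<rangle>)^(n + 1)\<close> over \<open>w \<in> L\<close> (\<open>vp_shift_near_origin\<close>).

  Both integrals can be differentiated under the integral sign. The first derivatives at the
  origin are multiples of the first moments of \<open>K\<close> and \<open>L\<close>, so that at a critical point both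
  barycenters vanish. With that, the products of first derivatives disappear from the second
  derivatives: the two diagonal blocks of the Hessian are second moments, hence multiples of
  \<open>cov L\<close> and \<open>cov K\<close>, and the mixed block is a multiple of the identity, because it arises only from
  the term \<open>\<langle>x, \<xi>\<rangle>\<close>. Altogether (\<open>hessian_vp_shift\<close>) the Hessian is \<open>(n + 1) vp(K)\<close> times the block
  matrix with rows \<open>((n + 2) cov L, -I)\<close> and \<open>(-I, (n + 2) cov K)\<close>.

  What remains is linear algebra. Since \<open>cov K\<close> is positive definite, completing the square shows
  that this block matrix is positive semidefinite exactly if its Schur complement
  \<open>(n + 2) cov L - ((n + 2) cov K)\<^sup>-\<^sup>1\<close> is (\<open>psd_block_minus_mat_iff\<close>), and its determinant is
  \<open>det((n + 2)\<^sup>2 cov L cov K - I)\<close> (\<open>det_block_minus_mat\<close>).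
\<close>

section \<open>Block matrices\<close>

definition block_matrix ::
    "'a^'n^'n \<Rightarrow> 'a^'m^'n \<Rightarrow> 'a^'n^'m \<Rightarrow> 'a^'m^'m \<Rightarrow> 'a^('n + 'm)^('n + 'm)" where
  "block_matrix P Q R S = (\<chi> a b. case a of
      Inl i \<Rightarrow> (case b of Inl j \<Rightarrow> P $ i $ j | Inr j \<Rightarrow> Q $ i $ j)
    | Inr i \<Rightarrow> (case b of Inl j \<Rightarrow> R $ i $ j | Inr j \<Rightarrow> S $ i $ j))"

lemma block_matrix_nth [simp]:
  "block_matrix P Q R S $ Inl i $ Inl j = P $ i $ j"
  "block_matrix P Q R S $ Inl i $ Inr j' = Q $ i $ j'"
  "block_matrix P Q R S $ Inr i' $ Inl j = R $ i' $ j"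
  "block_matrix P Q R S $ Inr i' $ Inr j' = S $ i' $ j'"
  by (simp_all add: block_matrix_def)

lemma block_matrix_eqI:
  assumes "\<And>i j. M $ Inl i $ Inl j = P $ i $ j" "\<And>i j. M $ Inl i $ Inr j = Q $ i $ j"
    and "\<And>i j. M $ Inr i $ Inl j = R $ i $ j" "\<And>i j. M $ Inr i $ Inr j = S $ i $ j"
  shows "M = block_matrix P Q R S"
  using assms by (auto simp: vec_eq_iff block_matrix_def split: sum.split)

lemma sum_UNIV_sum_type:
  fixes f :: "('n::finite + 'm::finite) \<Rightarrow> 'a::comm_monoid_add"
  shows "(\<Sum>a\<in>UNIV. f a) = (\<Sum>i\<in>UNIV. f (Inl i)) + (\<Sum>j\<in>UNIV. f (Inr j))"
  by (subst UNIV_Plus_UNIV[symmetric], subst sum.Plus) (auto simp: o_def)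

lemma prod_UNIV_sum_type:
  fixes f :: "('n::finite + 'm::finite) \<Rightarrow> 'a::comm_monoid_mult"
  shows "(\<Prod>a\<in>UNIV. f a) = (\<Prod>i\<in>UNIV. f (Inl i)) * (\<Prod>j\<in>UNIV. f (Inr j))"
  by (subst UNIV_Plus_UNIV[symmetric], subst prod.Plus) (auto simp: o_def)

lemma block_matrix_mult:
  "block_matrix P Q R S ** block_matrix P' Q' R' S' =
     block_matrix (P ** P' + Q ** R') (P ** Q' + Q ** S') (R ** P' + S ** R') (R ** Q' + S ** S')"
  by (rule block_matrix_eqI) (simp_all add: matrix_matrix_mult_def sum_UNIV_sum_type)

lemma transpose_block_matrix:
  "transpose (block_matrix P Q R S) =
     block_matrix (transpose P) (transpose R) (transpose Q) (transpose S)"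
  by (rule block_matrix_eqI) (simp_all add: transpose_def)

lemma permutes_map_sum:
  assumes "q permutes (UNIV :: 'n::finite set)" "r permutes (UNIV :: 'm::finite set)"
  shows "map_sum q r permutes UNIV"
proof -
  have "bij q" "bij r" using assms by (auto simp: permutes_bij)
  have "inj (map_sum q r)"
  proof (rule injI)
    fix a b assume "map_sum q r a = map_sum q r b"
    then show "a = b" using \<open>bij q\<close> \<open>bij r\<close> by (cases a; cases b) (simp_all add: bij_def inj_eq)
  qed
  then have "bij (map_sum q r)" by (simp add: finite_UNIV_inj_surj bij_def)
  then show ?thesis by (intro bij_imp_permutes) auto
qed

lemma sign_map_sum:
  assumes q: "q permutes (UNIV :: 'n::finite set)" and r: "r permutes (UNIV :: 'm::finite set)"
  shows "sign (map_sum q r) = sign q * sign r"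
proof -
  have 1: "map_permutation UNIV Inl q = map_sum q (id :: 'm \<Rightarrow> 'm)"
    unfolding map_permutation_def restrict_id_def
  proof (rule ext)
    fix a show "(if a \<in> range Inl then (Inl \<circ> q \<circ> inv_into UNIV Inl) a else a) = map_sum q id a"
      by (cases a) auto
  qed
  have 2: "map_permutation UNIV Inr r = map_sum (id :: 'n \<Rightarrow> 'n) r"
    unfolding map_permutation_def restrict_id_def
  proof (rule ext)
    fix a show "(if a \<in> range Inr then (Inr \<circ> r \<circ> inv_into UNIV Inr) a else a) = map_sum id r a"
      by (cases a) auto
  qed
  have "sign (map_sum q r) = sign (map_sum q (id :: 'm \<Rightarrow> 'm) \<circ> map_sum (id :: 'n \<Rightarrow> 'n) r)"
    by (simp add: map_sum.comp)
  also have "\<dots> = sign (map_sum q (id :: 'm \<Rightarrow> 'm)) * sign (map_sum (id :: 'n \<Rightarrow> 'n) r)"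
    using permutes_map_sum[OF q permutes_id] permutes_map_sum[OF permutes_id r]
    by (intro sign_compose) (auto simp: permutation_permutes intro: finite)
  also have "\<dots> = sign q * sign r"
    using sign_map_permutation[of "Inl :: 'n \<Rightarrow> 'n + 'm" UNIV q]
      sign_map_permutation[of "Inr :: 'm \<Rightarrow> 'n + 'm" UNIV r] q r by (simp add: 1 2)
  finally show ?thesis .
qed

text \<open>
  By counting, a permutation that maps the right summand into itself maps it onto itself, and
  therefore maps the left summand into itself as well.
\<close>
lemma permutes_sum_preserving_Inr:
  assumes p: "p permutes (UNIV :: ('n::finite + 'm::finite) set)" and Inr: "\<And>i. p (Inr i) \<in> range Inr"
  shows "\<exists>q r. q permutes UNIV \<and> r permutes UNIV \<and> p = map_sum q r"
proof -
  have inj: "inj p" using p by (simp add: permutes_inj)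
  have "p ` range Inr \<subseteq> range Inr" using Inr by auto
  then have eq: "p ` range Inr = range Inr"
    using card_image[OF inj_on_subset[OF inj subset_UNIV]] by (intro card_subset_eq) auto
  have Inl: "p (Inl i) \<in> range Inl" for i
  proof (cases "p (Inl i)")
    case (Inr j)
    then have "p (Inl i) \<in> p ` range Inr" by (simp add: eq)
    then show ?thesis using inj by (auto simp: inj_def)
  qed auto
  have "\<forall>i. \<exists>j. p (Inl i) = Inl j" using Inl by blast
  then obtain q where q: "\<And>i. p (Inl i) = Inl (q i)" by metis
  have "\<forall>i. \<exists>j. p (Inr i) = Inr j" using Inr by blast
  then obtain r where r: "\<And>i. p (Inr i) = Inr (r i)" by metis
  have "inj q" by (rule injI, rule Inl_inject, rule injD[OF inj]) (simp add: q)
  moreover have "inj r" by (rule injI, rule Inr_inject, rule injD[OF inj]) (simp add: r)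
  moreover have "p = map_sum q r"
  proof (rule ext)
    fix a show "p a = map_sum q r a" by (cases a) (simp_all add: q r)
  qed
  ultimately show ?thesis
    by (intro exI[of _ q] exI[of _ r] conjI bij_imp_permutes) (auto simp: bij_def finite_UNIV_inj_surj)
qed

text \<open>
  In the Leibniz expansion, a permutation sending some index of the second block to the first
  block picks up an entry of the zero block. The surviving permutations split into one
  permutation of each block, with multiplicative sign.
\<close>
lemma det_block_upper_triangular:
  fixes P :: "'a::comm_ring_1^'n^'n" and S :: "'a^'m^'m"
  shows "det (block_matrix P Q 0 S) = det P * det S"
proof -
  let ?M = "block_matrix P Q 0 S"
  let ?t = "\<lambda>p. of_int (sign p) * (\<Prod>a\<in>UNIV. ?M $ a $ p a)"
  let ?Q = "{q. q permutes (UNIV :: 'n set)}" and ?R = "{r. r permutes (UNIV :: 'm set)}"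
  let ?I = "(\<lambda>(q, r). map_sum q r) ` (?Q \<times> ?R)"
  have inj: "inj_on (\<lambda>(q, r). map_sum q r) (?Q \<times> ?R)"
  proof (rule inj_onI, clarify)
    fix q q' :: "'n \<Rightarrow> 'n" and r r' :: "'m \<Rightarrow> 'm" assume eq: "map_sum q r = map_sum q' r'"
    have "q i = q' i" for i using fun_cong[OF eq, of "Inl i"] by simp
    moreover have "r j = r' j" for j using fun_cong[OF eq, of "Inr j"] by simp
    ultimately show "q = q' \<and> r = r'" by auto
  qed
  have "det ?M = sum ?t ?I"
    unfolding det_def
  proof (rule sum.mono_neutral_right)
    show "?I \<subseteq> {p. p permutes UNIV}" by (auto intro: permutes_map_sum)
    show "\<forall>p\<in>{p. p permutes UNIV} - ?I. ?t p = 0"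
    proof
      fix p assume p: "p \<in> {p. p permutes UNIV} - ?I"
      then obtain i where "p (Inr i) \<notin> range Inr"
        using permutes_sum_preserving_Inr[of p] by force
      then obtain j where "p (Inr i) = Inl j" by (cases "p (Inr i)") auto
      then have "?M $ Inr i $ p (Inr i) = 0" by simp
      then show "?t p = 0" by (metis UNIV_I finite mult_zero_right prod_zero)
    qed
  qed (simp add: finite_permutations)
  also have "\<dots> = (\<Sum>(q, r)\<in>?Q \<times> ?R. ?t (map_sum q r))"
    by (subst sum.reindex[OF inj]) (simp add: case_prod_unfold o_def)
  also have "\<dots> = (\<Sum>(q, r)\<in>?Q \<times> ?R. (of_int (sign q) * (\<Prod>i\<in>UNIV. P $ i $ q i)) *
      (of_int (sign r) * (\<Prod>i\<in>UNIV. S $ i $ r i)))"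
    by (intro sum.cong) (auto simp: prod_UNIV_sum_type sign_map_sum algebra_simps)
  also have "\<dots> = det P * det S"
    unfolding det_def by (simp add: sum_product sum.cartesian_product)
  finally show ?thesis .
qed

lemma transpose_0: "transpose 0 = 0"
  by (simp add: vec_eq_iff transpose_def)

lemma det_block_lower_triangular:
  fixes P :: "'a::comm_ring_1^'n^'n" and S :: "'a^'m^'m"
  shows "det (block_matrix P 0 R S) = det P * det S"
proof -
  have "transpose (block_matrix P 0 R S) = block_matrix (transpose P) (transpose R) 0 (transpose S)"
    using transpose_block_matrix[of P 0 R S] by (simp add: transpose_0)
  then show ?thesis
    using det_transpose[of "block_matrix P 0 R S"]
    by (simp add: det_block_upper_triangular det_transpose)
qed

text \<open>
  Multiplying on the right by the lower block triangular matrix with rows \<open>(B, 0)\<close> and \<open>(I, I)\<close>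
  clears the lower left block and leaves \<open>A B - I\<close> and \<open>B\<close> on the diagonal. This multiplies the
  determinant by \<open>det B\<close>, which is then cancelled.
\<close>
lemma det_block_minus_mat:
  fixes A B :: "'a::field^'n^'n"
  assumes "invertible B"
  shows "det (block_matrix A (- mat 1) (- mat 1) B) = det (A ** B - mat 1)"
proof -
  let ?M = "block_matrix A (- mat 1) (- mat 1) B" and ?N = "block_matrix B 0 (mat 1) (mat 1)"
  have neg: "(- mat 1) ** X = - X" for X :: "'a^'n^'n"
  proof -
    have "(- mat 1) ** X = - (mat 1 ** X)" by (simp add: vec_eq_iff matrix_matrix_mult_def sum_negf)
    then show ?thesis by simp
  qed
  have z: "X ** 0 = 0" for X :: "'a^'n^'n"
    by (simp add: vec_eq_iff matrix_matrix_mult_def)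
  have "?M ** ?N = block_matrix (A ** B - mat 1) (- mat 1) 0 B"
    by (simp add: block_matrix_mult neg z)
  then have "det ?M * det B = det (A ** B - mat 1) * det B"
    using det_mul[of ?M ?N]
    by (auto simp: det_block_upper_triangular det_block_lower_triangular)
  moreover have "det B \<noteq> 0" using assms by (simp add: invertible_det_nz)
  ultimately show ?thesis by simp
qed

definition join_vec :: "'a^'n \<Rightarrow> 'a^'m \<Rightarrow> 'a^('n + 'm)" where
  "join_vec x y = (\<chi> a. case a of Inl i \<Rightarrow> x $ i | Inr j \<Rightarrow> y $ j)"

lemma join_vec_nth [simp]: "join_vec x y $ Inl i = x $ i" "join_vec x y $ Inr j = y $ j"
  by (simp_all add: join_vec_def)

lemma join_vec_exhaust: obtains x y where "v = join_vec x y"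
proof
  show "v = join_vec (\<chi> i. v $ Inl i) (\<chi> j. v $ Inr j)"
    by (simp add: vec_eq_iff join_vec_def split: sum.split)
qed

lemma block_matrix_vector_mult:
  "block_matrix P Q R S *v join_vec x y = join_vec (P *v x + Q *v y) (R *v x + S *v y)"
  by (simp add: vec_eq_iff join_vec_def matrix_vector_mult_def sum_UNIV_sum_type split: sum.split)

lemma inner_join_vec:
  fixes x x' :: "real^'n" and y y' :: "real^'m"
  shows "join_vec x y \<bullet> join_vec x' y' = x \<bullet> x' + y \<bullet> y'"
  by (simp add: inner_vec_def sum_UNIV_sum_type)

lemma psd_scaleR_iff:
  assumes "c > 0"
  shows "psd (c *\<^sub>R M) \<longleftrightarrow> psd M"
  using assms
  by (simp add: psd_def transpose_scalar scaleR_matrix_vector_assoc[symmetric] zero_le_mult_iff)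

lemma matrix_inv_inverse:
  assumes "invertible A"
  shows "A ** matrix_inv A = mat 1" "matrix_inv A ** A = mat 1"
  using assms unfolding invertible_def matrix_inv_def by (metis (mono_tags, lifting) someI_ex)+

lemma matrix_inv_unique:
  assumes "A ** B = mat 1" "B ** A = mat 1"
  shows "matrix_inv A = B"
proof -
  have "invertible A" using assms by (auto simp: invertible_def)
  then show ?thesis by (metis assms(1) matrix_inv_inverse(2) matrix_mul_assoc matrix_mul_lid matrix_mul_rid)
qed

lemma transpose_matrix_inv:
  fixes B :: "real^'n^'n"
  assumes "invertible B" "transpose B = B"
  shows "transpose (matrix_inv B) = matrix_inv B"
proof (rule matrix_inv_unique[symmetric])
  show "B ** transpose (matrix_inv B) = mat 1"
    using arg_cong[OF matrix_inv_inverse(2)[OF assms(1)], of transpose]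
    by (simp add: matrix_transpose_mul transpose_mat assms(2))
  show "transpose (matrix_inv B) ** B = mat 1"
    using arg_cong[OF matrix_inv_inverse(1)[OF assms(1)], of transpose]
    by (simp add: matrix_transpose_mul transpose_mat assms(2))
qed

text \<open>
  The quadratic form of the block matrix at \<open>(x, y)\<close> is \<open>\<langle>x, A x\<rangle> - 2 \<langle>x, y\<rangle> + \<langle>y, B y\<rangle>\<close>. For
  fixed \<open>x\<close> it is minimal at \<open>y = B\<^sup>-\<^sup>1 x\<close>, with minimum \<open>\<langle>x, (A - B\<^sup>-\<^sup>1) x\<rangle>\<close>.
\<close>
lemma psd_block_minus_mat_iff:
  fixes A B :: "real^'n^'n"
  assumes B: "psd B" and inv: "invertible B"
  shows "psd (block_matrix A (- mat 1) (- mat 1) B) \<longleftrightarrow> psd (A - matrix_inv B)"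
proof -
  let ?C = "matrix_inv B" and ?M = "block_matrix A (- mat 1) (- mat 1) B"
  have symB: "transpose B = B" and posB: "\<And>v. 0 \<le> v \<bullet> (B *v v)" using B by (auto simp: psd_def)
  have symC: "transpose ?C = ?C" using transpose_matrix_inv[OF inv symB] .
  have neg: "(- mat 1) *v v = - v" for v :: "real^'n"
  proof -
    have "(- mat 1) *v v = - (mat 1 *v v)" by (simp add: vec_eq_iff matrix_vector_mult_def sum_negf)
    then show ?thesis by simp
  qed
  have BC: "B *v (?C *v x) = x" for x
    by (simp add: matrix_vector_mul_assoc matrix_inv_inverse[OF inv])
  have adj: "x \<bullet> (B *v y) = (B *v x) \<bullet> y" for x y
    by (metis symB dot_lmul_matrix transpose_matrix_vector)
  have q: "join_vec x y \<bullet> (?M *v join_vec x y) = x \<bullet> (A *v x) - 2 * (x \<bullet> y) + y \<bullet> (B *v y)" for x y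
    by (simp add: block_matrix_vector_mult inner_join_vec neg algebra_simps inner_commute)
  have complete_square: "join_vec x y \<bullet> (?M *v join_vec x y) =
      x \<bullet> ((A - ?C) *v x) + (y - ?C *v x) \<bullet> (B *v (y - ?C *v x))" for x y
    unfolding q using adj[of "?C *v x" y] 
    by (simp add: algebra_simps BC inner_commute)
  have "transpose ?M = ?M \<longleftrightarrow> transpose A = A"
  proof -
    have "transpose (- mat 1) = (- mat 1 :: real^'n^'n)" by (simp add: vec_eq_iff transpose_def mat_def)
    then show ?thesis
      unfolding transpose_block_matrix by (simp add: symB) (metis block_matrix_nth(1) vec_eq_iff)
  qed
  moreover have "transpose (A - ?C) = A - ?C \<longleftrightarrow> transpose A = A"
  proof -
    have "transpose (A - ?C) = transpose A - transpose ?C" by (simp add: vec_eq_iff transpose_def)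
    then show ?thesis by (simp add: symC)
  qed
  moreover have "(\<forall>v. 0 \<le> v \<bullet> (?M *v v)) \<longleftrightarrow> (\<forall>x. 0 \<le> x \<bullet> ((A - ?C) *v x))"
  proof
    assume *: "\<forall>v. 0 \<le> v \<bullet> (?M *v v)"
    show "\<forall>x. 0 \<le> x \<bullet> ((A - ?C) *v x)"
    proof
      fix x show "0 \<le> x \<bullet> ((A - ?C) *v x)"
        using *[rule_format, of "join_vec x (?C *v x)"] unfolding complete_square by simp
    qed
  next
    assume *: "\<forall>x. 0 \<le> x \<bullet> ((A - ?C) *v x)"
    show "\<forall>v. 0 \<le> v \<bullet> (?M *v v)"
    proof
      fix v show "0 \<le> v \<bullet> (?M *v v)"
        by (cases v rule: join_vec_exhaust) (simp only: complete_square * posB add_nonneg_nonneg)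
    qed
  qed
  ultimately show ?thesis by (simp add: psd_def)
qed

section \<open>The volume of a projective image\<close>

lemma nn_integral_lborel_homothety:
  fixes f :: "'a::euclidean_space \<Rightarrow> ennreal"
  assumes [measurable]: "f \<in> borel_measurable borel" and "c > 0"
  shows "(\<integral>\<^sup>+ y. f (y /\<^sub>R c) \<partial>lborel) = ennreal (c ^ DIM('a)) * (\<integral>\<^sup>+ x. f x \<partial>lborel)"
proof -
  have "(\<integral>\<^sup>+ y. f (y /\<^sub>R c) \<partial>lborel)
      = (\<integral>\<^sup>+ y. f (y /\<^sub>R c) \<partial>density (distr lborel borel (\<lambda>x. 0 + c *\<^sub>R x)) (\<lambda>_. ennreal (\<bar>c\<bar> ^ DIM('a))))"
    using assms(2) by (subst lborel_affine[of c 0]) auto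
  also have "\<dots> = (\<integral>\<^sup>+ x. ennreal (c ^ DIM('a)) * f x \<partial>lborel)"
    using assms(2) by (simp add: nn_integral_density nn_integral_distr)
  also have "\<dots> = ennreal (c ^ DIM('a)) * (\<integral>\<^sup>+ x. f x \<partial>lborel)"
    by (simp add: nn_integral_cmult)
  finally show ?thesis .
qed

lemma nn_integral_power_Ioc:
  assumes "n > 0" "b \<ge> 0"
  shows "(\<integral>\<^sup>+ s. ennreal (s ^ n) * indicator {0<..b} s \<partial>lborel) = ennreal (b ^ Suc n / Suc n)"
proof -
  have "(\<integral>\<^sup>+ s. ennreal (s ^ n) * indicator {0<..b} s \<partial>lborel)
      = (\<integral>\<^sup>+ s. ennreal (s ^ n) * indicator {0..b} s \<partial>lborel)"
    using assms by (intro nn_integral_cong) (auto simp: indicator_def)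
  also have "\<dots> = ennreal (b ^ Suc n / Suc n - 0 ^ Suc n / Suc n)"
    using assms
    by (intro nn_integral_FTC_Icc) (auto intro!: derivative_eq_intros simp del: power_Suc of_nat_Suc)
  finally show ?thesis by simp
qed

text \<open>
  The left-hand side is the volume of the part of the cone \<open>{(s, y). s > 0, y \<in> s A}\<close> that lies
  in the half-space \<open>s + \<langle>\<xi>, y\<rangle> \<le> 1\<close>. Substituting \<open>y = s k\<close> with \<open>k \<in> A\<close> contributes the factor
  \<open>s\<^sup>n\<close> and turns the half-space into \<open>s \<le> 1 / (1 + \<langle>\<xi>, k\<rangle>)\<close>.
\<close>
lemma nn_integral_cone_slices:
  fixes A :: "'a::euclidean_space set"
  assumes A [measurable]: "A \<in> sets borel" and pos: "\<And>k. k \<in> A \<Longrightarrow> 0 < 1 + \<xi> \<bullet> k"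
  shows "(\<integral>\<^sup>+ y. (\<integral>\<^sup>+ s. indicator {s. 0 < s \<and> y /\<^sub>R s \<in> A \<and> s + \<xi> \<bullet> y \<le> 1} s \<partial>lborel) \<partial>lborel) =
    (\<integral>\<^sup>+ k. ennreal (1 / (Suc DIM('a) * (1 + \<xi> \<bullet> k) ^ Suc DIM('a))) * indicator A k \<partial>lborel)"
    (is "?lhs = ?rhs")
proof -
  let ?E = "{p :: real \<times> 'a. 0 < fst p \<and> snd p /\<^sub>R fst p \<in> A \<and> fst p + \<xi> \<bullet> snd p \<le> 1}"
  let ?D = "{p :: real \<times> 'a. 0 < fst p \<and> snd p \<in> A \<and> fst p * (1 + \<xi> \<bullet> snd p) \<le> 1}"
  have sets_eq: "sets (lborel \<Otimes>\<^sub>M lborel) = sets (borel \<Otimes>\<^sub>M (borel :: 'a measure))"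
    by (intro sets_pair_measure_cong) auto
  have "{p \<in> space (borel \<Otimes>\<^sub>M (borel :: 'a measure)). 0 < fst p \<and> snd p /\<^sub>R fst p \<in> A \<and> fst p + \<xi> \<bullet> snd p \<le> 1}
      \<in> sets (borel \<Otimes>\<^sub>M borel)"
    by measurable
  then have [measurable]: "?E \<in> sets (lborel \<Otimes>\<^sub>M lborel)"
    by (simp add: sets_eq space_pair_measure)
  have "{p \<in> space (borel \<Otimes>\<^sub>M (borel :: 'a measure)). 0 < fst p \<and> snd p \<in> A \<and> fst p * (1 + \<xi> \<bullet> snd p) \<le> 1}
      \<in> sets (borel \<Otimes>\<^sub>M borel)"
    by measurable
  then have [measurable]: "?D \<in> sets (lborel \<Otimes>\<^sub>M lborel)"
    by (simp add: sets_eq space_pair_measure)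
  have "?lhs = (\<integral>\<^sup>+ y. (\<integral>\<^sup>+ s. indicator ?E (s, y) \<partial>lborel) \<partial>lborel)"
    by (intro nn_integral_cong) (auto simp: indicator_def)
  also have "\<dots> = (\<integral>\<^sup>+ s. (\<integral>\<^sup>+ y. indicator ?E (s, y) \<partial>lborel) \<partial>lborel)"
    by (rule lborel_pair.Fubini') measurable
  also have "\<dots> = (\<integral>\<^sup>+ s. (\<integral>\<^sup>+ k. ennreal (s ^ DIM('a)) * indicator ?D (s, k) \<partial>lborel) \<partial>lborel)"
  proof (rule nn_integral_cong)
    fix s :: real
    show "(\<integral>\<^sup>+ y. indicator ?E (s, y) \<partial>lborel) =
      (\<integral>\<^sup>+ k. ennreal (s ^ DIM('a)) * indicator ?D (s, k) \<partial>lborel)"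
    proof (cases "s > 0")
      case True
      have "(\<integral>\<^sup>+ y. indicator ?E (s, y) \<partial>lborel) = (\<integral>\<^sup>+ y. indicator ?D (s, y /\<^sub>R s) \<partial>(lborel :: 'a measure))"
        using True by (intro nn_integral_cong) (auto simp: indicator_def distrib_left mult.assoc[symmetric])
      also have "\<dots> = ennreal (s ^ DIM('a)) * (\<integral>\<^sup>+ k. indicator ?D (s, k) \<partial>lborel)"
        using True by (intro nn_integral_lborel_homothety) measurable
      also have "\<dots> = (\<integral>\<^sup>+ k. ennreal (s ^ DIM('a)) * indicator ?D (s, k) \<partial>lborel)"
        by (subst nn_integral_cmult) measurable
      finally show ?thesis .
    qed simp
  qed
  also have "\<dots> = (\<integral>\<^sup>+ k. (\<integral>\<^sup>+ s. ennreal (s ^ DIM('a)) * indicator ?D (s, k) \<partial>lborel) \<partial>lborel)"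
    by (rule lborel_pair.Fubini'[symmetric]) measurable
  also have "\<dots> = ?rhs"
  proof (rule nn_integral_cong)
    fix k :: 'a
    show "(\<integral>\<^sup>+ s. ennreal (s ^ DIM('a)) * indicator ?D (s, k) \<partial>lborel) =
      ennreal (1 / (Suc DIM('a) * (1 + \<xi> \<bullet> k) ^ Suc DIM('a))) * indicator A k"
    proof (cases "k \<in> A")
      case True
      define a where "a = 1 + \<xi> \<bullet> k"
      have a: "a > 0" using pos[OF True] by (simp add: a_def)
      have "(\<integral>\<^sup>+ s. ennreal (s ^ DIM('a)) * indicator ?D (s, k) \<partial>lborel) =
        (\<integral>\<^sup>+ s. ennreal (s ^ DIM('a)) * indicator {0<..1 / a} s \<partial>lborel)"
        using True a by (intro nn_integral_cong) (auto simp: indicator_def a_def field_simps)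
      also have "\<dots> = ennreal ((1 / a) ^ Suc DIM('a) / Suc DIM('a))"
        using a by (intro nn_integral_power_Ioc) auto
      finally show ?thesis using True unfolding a_def[symmetric] by (simp add: power_divide mult_ac)
    qed simp
  qed
  finally show ?thesis .
qed

text \<open>
  A projective map is the trace of a linear map on cones. The volume preserving shear
  \<open>(s, y) \<mapsto> (s + \<langle>\<xi>, y\<rangle>, y)\<close> carries the cone over \<open>A\<close> to the cone over its projective image \<open>P\<close>,
  and the half-space \<open>s + \<langle>\<xi>, y\<rangle> \<le> 1\<close> to \<open>r \<le> 1\<close>. Cutting off the cones there and computing both
  volumes by slices gives the formula, without the Jacobian determinant of the projective map.
\<close>
lemma emeasure_projective_image:
  fixes A :: "'a::euclidean_space set"
  assumes A: "compact A" and pos: "\<And>k. k \<in> A \<Longrightarrow> 0 < 1 + \<xi> \<bullet> k"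
  defines "P \<equiv> (\<lambda>k. k /\<^sub>R (1 + \<xi> \<bullet> k)) ` A"
  shows "emeasure lborel P = (\<integral>\<^sup>+ k. ennreal (1 / (1 + \<xi> \<bullet> k) ^ Suc DIM('a)) * indicator A k \<partial>lborel)"
proof -
  let ?N = "ennreal (1 / Suc DIM('a))"
  have [measurable]: "A \<in> sets borel" using A by (simp add: borel_compact)
  have "compact P"
    unfolding P_def using A pos
    by (intro compact_continuous_image continuous_intros) (auto simp: less_imp_neq[symmetric])
  then have [measurable]: "P \<in> sets borel" by (simp add: borel_compact)
  have shear: "0 < t + s \<and> y /\<^sub>R (t + s) \<in> P \<longleftrightarrow> 0 < s \<and> y /\<^sub>R s \<in> A" if t: "t = \<xi> \<bullet> y" for s t and y :: 'a
  proof
    assume *: "0 < t + s \<and> y /\<^sub>R (t + s) \<in> P"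
    then obtain k where k: "k \<in> A" "y /\<^sub>R (t + s) = k /\<^sub>R (1 + \<xi> \<bullet> k)" by (auto simp: P_def)
    define a where "a = 1 + \<xi> \<bullet> k"
    have a: "a > 0" using pos[OF k(1)] by (simp add: a_def)
    have y: "y = ((t + s) / a) *\<^sub>R k"
      using arg_cong[OF k(2), of "\<lambda>v. (t + s) *\<^sub>R v"] * by (simp add: a_def field_simps)
    have "t = (t + s) / a * (a - 1)" using t unfolding y by (simp add: a_def)
    then have s: "s = (t + s) / a" using a by (simp add: field_simps)
    then have "s > 0" using * a by (metis divide_pos_pos)
    moreover have "y /\<^sub>R s = k" using y \<open>s > 0\<close> unfolding s[symmetric] by simp
    ultimately show "0 < s \<and> y /\<^sub>R s \<in> A" using k(1) by simp
  next
    assume *: "0 < s \<and> y /\<^sub>R s \<in> A"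
    define k where "k = y /\<^sub>R s"
    have y: "y = s *\<^sub>R k" using * by (simp add: k_def)
    have eq: "t + s = s * (1 + \<xi> \<bullet> k)" unfolding t y by (simp add: algebra_simps)
    have "k \<in> A" using * by (simp add: k_def)
    then have "0 < 1 + \<xi> \<bullet> k" by (rule pos)
    moreover have "y /\<^sub>R (t + s) = k /\<^sub>R (1 + \<xi> \<bullet> k)" unfolding eq y using * by simp
    ultimately show "0 < t + s \<and> y /\<^sub>R (t + s) \<in> P"
      using * \<open>k \<in> A\<close> by (simp only: P_def eq) auto
  qed
  have "?N * emeasure lborel P = (\<integral>\<^sup>+ y. ?N * indicator P y \<partial>lborel)"
    by (subst nn_integral_cmult) auto
  also have "\<dots> = (\<integral>\<^sup>+ y. (\<integral>\<^sup>+ s. indicator {s. 0 < s \<and> y /\<^sub>R s \<in> P \<and> s \<le> 1} s \<partial>lborel) \<partial>lborel)"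
    using nn_integral_cone_slices[of P 0] by simp
  also have "\<dots> = (\<integral>\<^sup>+ y. (\<integral>\<^sup>+ s. indicator {s. 0 < s \<and> y /\<^sub>R s \<in> A \<and> s + \<xi> \<bullet> y \<le> 1} s \<partial>lborel) \<partial>lborel)"
  proof (rule nn_integral_cong)
    fix y :: 'a
    have [measurable]: "{s. 0 < s \<and> y /\<^sub>R s \<in> P \<and> s \<le> 1} \<in> sets borel" by measurable
    have "(\<integral>\<^sup>+ s. indicator {s. 0 < s \<and> y /\<^sub>R s \<in> P \<and> s \<le> 1} s \<partial>lborel) =
      (\<integral>\<^sup>+ s. indicator {s. 0 < s \<and> y /\<^sub>R s \<in> P \<and> s \<le> 1} (\<xi> \<bullet> y + 1 * s) \<partial>lborel)"
      using nn_integral_real_affine[of "indicator {s. 0 < s \<and> y /\<^sub>R s \<in> P \<and> s \<le> 1}" 1 "\<xi> \<bullet> y"] by simp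
    also have "\<dots> = (\<integral>\<^sup>+ s. indicator {s. 0 < s \<and> y /\<^sub>R s \<in> A \<and> s + \<xi> \<bullet> y \<le> 1} s \<partial>lborel)"
      using shear[OF refl, of y] by (intro nn_integral_cong) (simp add: indicator_def add.commute conj_assoc[symmetric] del: conj_assoc)
    finally show "(\<integral>\<^sup>+ s. indicator {s. 0 < s \<and> y /\<^sub>R s \<in> P \<and> s \<le> 1} s \<partial>lborel) =
      (\<integral>\<^sup>+ s. indicator {s. 0 < s \<and> y /\<^sub>R s \<in> A \<and> s + \<xi> \<bullet> y \<le> 1} s \<partial>lborel)" .
  qed
  also have "\<dots> = (\<integral>\<^sup>+ k. ?N * (ennreal (1 / (1 + \<xi> \<bullet> k) ^ Suc DIM('a)) * indicator A k) \<partial>lborel)"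
    using pos by (subst nn_integral_cone_slices)
      (auto intro!: nn_integral_cong simp: indicator_def ennreal_mult'[symmetric] simp del: power_Suc of_nat_Suc)
  also have "\<dots> = ?N * (\<integral>\<^sup>+ k. ennreal (1 / (1 + \<xi> \<bullet> k) ^ Suc DIM('a)) * indicator A k \<partial>lborel)"
    by (subst nn_integral_cmult) auto
  finally show ?thesis
    by (subst (asm) ennreal_mult_cancel_left) (auto simp del: of_nat_Suc)
qed

section \<open>Integrals of inverse powers of affine functions\<close>

text \<open>
  The constant \<open>c\<close> is an argument of its own so that translates of \<open>A\<close> are covered: integrating
  \<open>1 / (1 + \<langle>u, v\<rangle>)^m\<close> over \<open>v \<in> \<xi> + A\<close> amounts to taking \<open>c = \<langle>u, \<xi>\<rangle>\<close>. Weights and exponents are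
  general because the partial derivatives are then integrals of the same kind.
\<close>
definition weighted_integral ::
    "'a::euclidean_space set \<Rightarrow> ('a \<Rightarrow> real) \<Rightarrow> nat \<Rightarrow> 'a \<times> real \<Rightarrow> real" where
  "weighted_integral A g m = (\<lambda>(u, c). LINT w:A|lborel. g w / (1 + c + u \<bullet> w) ^ m)"

lemma set_integrable_compact:
  fixes f :: "'a::euclidean_space \<Rightarrow> real"
  assumes "compact A" "continuous_on A f"
  shows "set_integrable lborel A f"
  unfolding set_integrable_def by (rule borel_integrable_compact[OF assms])

lemma measure_projective_image:
  fixes A :: "'a::euclidean_space set"
  assumes A: "compact A" and pos: "\<And>w. w \<in> A \<Longrightarrow> 0 < 1 + x \<bullet> \<xi> + x \<bullet> w"
  shows "measure lebesgue ((\<lambda>k. k /\<^sub>R (1 + x \<bullet> k)) ` (+) \<xi> ` A) =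
    weighted_integral A (\<lambda>_. 1) (Suc DIM('a)) (x, x \<bullet> \<xi>)"
proof -
  let ?A = "(+) \<xi> ` A"
  let ?P = "(\<lambda>k. k /\<^sub>R (1 + x \<bullet> k)) ` ?A"
  let ?f = "\<lambda>k. 1 / (1 + x \<bullet> k) ^ Suc DIM('a)"
  let ?h = "\<lambda>w. indicator A w *\<^sub>R (1 / (1 + x \<bullet> \<xi> + x \<bullet> w) ^ Suc DIM('a))"
  have A': "compact ?A" using A by (rule compact_translation)
  have pos': "0 < 1 + x \<bullet> k" if "k \<in> ?A" for k
    using that pos by (auto simp: inner_add_right add.assoc)
  have [measurable]: "A \<in> sets borel" "?A \<in> sets borel" using A A' by (simp_all add: borel_compact)
  have "compact ?P"
    using pos' by (intro compact_continuous_image[OF _ A'] continuous_intros) (auto simp: less_imp_neq[symmetric])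
  then have P: "?P \<in> sets lborel" by (simp add: borel_compact)
  have "emeasure lborel ?P = (\<integral>\<^sup>+ k. ennreal (?f k) * indicator ?A k \<partial>lborel)"
    using A' pos' by (rule emeasure_projective_image)
  also have "\<dots> = (\<integral>\<^sup>+ k. ennreal (?f k) * indicator ?A k \<partial>distr lborel borel ((+) \<xi>))"
    by (simp add: lborel_distr_plus)
  also have "\<dots> = (\<integral>\<^sup>+ w. ennreal (?f (\<xi> + w)) * indicator ?A (\<xi> + w) \<partial>lborel)"
    by (subst nn_integral_distr) auto
  also have "\<dots> = (\<integral>\<^sup>+ w. ennreal (?h w) \<partial>lborel)"
    by (intro nn_integral_cong) (auto simp: indicator_def inner_add_right add.assoc)
  finally have em: "emeasure lborel ?P = (\<integral>\<^sup>+ w. ennreal (?h w) \<partial>lborel)" .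
  have "measure lebesgue ?P = measure lborel ?P" using P by (rule measure_completion)
  also have "\<dots> = enn2real (\<integral>\<^sup>+ w. ennreal (?h w) \<partial>lborel)" by (simp add: measure_def em)
  also have "\<dots> = (LINT w|lborel. ?h w)"
    using pos by (intro integral_eq_nn_integral[symmetric])
      (auto simp: indicator_def less_imp_le zero_le_mult_iff simp del: power_Suc)
  finally show ?thesis by (simp add: weighted_integral_def set_lebesgue_integral_def)
qed

text \<open>
  Away from \<open>0\<close> the second derivative of \<open>1 / x^m\<close> is bounded, so the first-order Taylor remainder
  is quadratic with a constant that does not depend on the base point. This uniformity is what
  allows differentiation under the integral sign.
\<close>
lemma inverse_power_quadratic_remainder:
  assumes "d > (0::real)"
  obtains C where "C \<ge> 0" "\<And>a b. d \<le> a \<Longrightarrow> d \<le> b \<Longrightarrow>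
    \<bar>1 / b ^ m - 1 / a ^ m + real m * (b - a) / a ^ Suc m\<bar> \<le> C * (b - a)\<^sup>2"
proof
  define f where "f i x = (if i = 0 then 1 / x ^ m else if i = 1 then - real m / x ^ Suc m
    else real m * real (Suc m) / x ^ Suc (Suc m))" for i :: nat and x :: real
  let ?C = "real m * real (Suc m) / d ^ Suc (Suc m)"
  show "?C \<ge> 0" using assms by simp
  have der: "(f i has_field_derivative f (Suc i) x) (at x within {d..})" if x: "x \<in> {d..}" and i: "i \<le> 1" for i x
  proof -
    have "x \<noteq> 0" using x assms by auto
    have D: "((\<lambda>x. 1 / x ^ k) has_field_derivative - real k / x ^ Suc k) (at x within {d..})" for k
    proof -
      have "((\<lambda>x. 1 / x ^ k) has_field_derivative - (real k * x ^ (k - Suc 0)) / (x ^ k * x ^ k)) (at x within {d..})"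
        using \<open>x \<noteq> 0\<close> by (auto intro!: derivative_eq_intros)
      also have "- (real k * x ^ (k - Suc 0)) / (x ^ k * x ^ k) = - real k / x ^ Suc k"
        using \<open>x \<noteq> 0\<close> by (cases k) (auto simp: field_simps)
      finally show ?thesis .
    qed
    from i consider "i = 0" | "i = 1" by linarith
    then show ?thesis
    proof cases
      case 1 then show ?thesis using D[of m] by (simp add: f_def[abs_def])
    next
      case 2
      have "((\<lambda>x. - real m * (1 / x ^ Suc m)) has_field_derivative - real m * (- real (Suc m) / x ^ Suc (Suc m)))
        (at x within {d..})"
        by (rule DERIV_cmult[OF D])
      then show ?thesis using 2 by (simp add: f_def[abs_def] del: power_Suc of_nat_Suc)
    qed
  qed
  have bound: "norm (f (Suc 1) x) \<le> ?C" if "x \<in> {d..}" for x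
    using assms that
    by (auto intro!: divide_left_mono power_mono mult_pos_pos simp del: power_Suc of_nat_Suc simp: f_def abs_mult)
  fix a b assume ab: "d \<le> a" "d \<le> b"
  have "norm (f 0 b - (\<Sum>i\<le>1. f i a * (b - a) ^ i / fact i)) \<le> ?C * norm (b - a) ^ Suc 1 / fact 1"
    using ab der bound by (intro field_Taylor[where S = "{d..}"]) auto
  then show "\<bar>1 / b ^ m - 1 / a ^ m + real m * (b - a) / a ^ Suc m\<bar> \<le> ?C * (b - a)\<^sup>2"
    by (simp add: f_def numeral_2_eq_2[symmetric] power2_eq_square algebra_simps)
qed

lemma linear_weighted_integral:
  assumes A: "compact A" and g: "continuous_on A g" and pos: "\<And>w. w \<in> A \<Longrightarrow> 0 < 1 + c + u \<bullet> w"
  shows "linear (\<lambda>q. weighted_integral A (\<lambda>w. g w * (fst q \<bullet> w + snd q)) m (u, c))"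
proof -
  have int: "set_integrable lborel A (\<lambda>w. g w * (fst q \<bullet> w + snd q) / (1 + c + u \<bullet> w) ^ m)" for q
    using A g pos by (intro set_integrable_compact continuous_intros) (auto simp: less_imp_neq[symmetric])
  show ?thesis
  proof (rule linearI)
    fix p q :: "'a \<times> real"
    show "weighted_integral A (\<lambda>w. g w * (fst (p + q) \<bullet> w + snd (p + q))) m (u, c) =
      weighted_integral A (\<lambda>w. g w * (fst p \<bullet> w + snd p)) m (u, c) +
      weighted_integral A (\<lambda>w. g w * (fst q \<bullet> w + snd q)) m (u, c)"
      unfolding weighted_integral_def using set_integral_add(2)[OF int[of p] int[of q]]
      by (simp add: algebra_simps add_divide_distrib inner_add_left)
  next
    fix r :: real and q :: "'a \<times> real"
    show "weighted_integral A (\<lambda>w. g w * (fst (r *\<^sub>R q) \<bullet> w + snd (r *\<^sub>R q))) m (u, c) =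
      r *\<^sub>R weighted_integral A (\<lambda>w. g w * (fst q \<bullet> w + snd q)) m (u, c)"
      unfolding weighted_integral_def
      by (simp add: algebra_simps add_divide_distrib flip: set_integral_mult_right)
  qed
qed

lemma has_derivative_weighted_integral:
  assumes A: "compact A" and g: "continuous_on A g" and pos: "\<And>w. w \<in> A \<Longrightarrow> 0 < 1 + c + u \<bullet> w"
  shows "(weighted_integral A g m has_derivative
    (\<lambda>q. - real m * weighted_integral A (\<lambda>w. g w * (fst q \<bullet> w + snd q)) (Suc m) (u, c))) (at (u, c))"
proof -
  let ?a = "\<lambda>w. 1 + c + u \<bullet> w"
  let ?D = "\<lambda>q. weighted_integral A (\<lambda>w. g w * (fst q \<bullet> w + snd q)) (Suc m) (u, c)"
  \<comment> \<open>The bases are at least \<open>2 d\<close> on \<open>A\<close>, and remain at least \<open>d\<close> after a small perturbation.\<close>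
  obtain d where d: "d > 0" "\<And>w. w \<in> A \<Longrightarrow> 2 * d \<le> ?a w"
  proof (cases "A = {}")
    case False
    have "continuous_on A ?a" by (intro continuous_intros)
    then obtain w0 where "w0 \<in> A" "\<And>w. w \<in> A \<Longrightarrow> ?a w0 \<le> ?a w"
      using continuous_attains_inf[OF A False] by blast
    then show ?thesis using pos by (intro that[of "?a w0 / 2"]) auto
  qed (use that[of 1] in auto)
  obtain R where R: "R > 0" "\<And>w. w \<in> A \<Longrightarrow> norm w \<le> R"
    using compact_imp_bounded[OF A] bounded_pos by blast
  obtain G where G: "G > 0" "\<And>w. w \<in> A \<Longrightarrow> \<bar>g w\<bar> \<le> G"
    using compact_imp_bounded[OF compact_continuous_image[OF g A]] unfolding bounded_pos by auto
  obtain C where C: "C \<ge> 0" "\<And>a b. d \<le> a \<Longrightarrow> d \<le> b \<Longrightarrow>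
    \<bar>1 / b ^ m - 1 / a ^ m + real m * (b - a) / a ^ Suc m\<bar> \<le> C * (b - a)\<^sup>2"
    using inverse_power_quadratic_remainder[OF d(1)] by blast
  define B where "B = G * (C * (R + 1)\<^sup>2) * measure lborel A"
  have B: "B \<ge> 0" using G C by (simp add: B_def)
  have q_bound: "\<bar>fst q \<bullet> w + snd q\<bar> \<le> (R + 1) * norm q" if "w \<in> A" for q w
  proof -
    have "\<bar>fst q \<bullet> w\<bar> \<le> norm (fst q) * norm w" by (rule Cauchy_Schwarz_ineq2)
    also have "\<dots> \<le> norm q * R"
      using R that norm_fst_le[of "fst q" "snd q"] by (intro mult_mono) auto
    finally show ?thesis using norm_snd_le[of "snd q" "fst q"] by (simp add: algebra_simps)
  qed
  have remainder: "\<bar>weighted_integral A g m ((u, c) + q) - weighted_integral A g m (u, c) + real m * ?D q\<bar>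
      \<le> B * (norm q)\<^sup>2" if q: "norm q < d / (R + 1)" for q
  proof -
    obtain u' c' where q': "q = (u', c')" by (cases q)
    let ?t = "\<lambda>w. u' \<bullet> w + c'"
    let ?b = "\<lambda>w. 1 + (c + c') + (u + u') \<bullet> w"
    let ?e = "\<lambda>w. g w / ?b w ^ m - g w / ?a w ^ m + real m * (g w * ?t w / ?a w ^ Suc m)"
    have t: "\<bar>?t w\<bar> \<le> (R + 1) * norm q" if "w \<in> A" for w using q_bound[OF that, of q] q' by simp
    have "(R + 1) * norm q < d" using q R by (simp add: field_simps)
    then have b: "d \<le> ?b w" if "w \<in> A" for w
      using t[OF that] d(2)[OF that] by (simp add: algebra_simps inner_add_left)
    have a: "d \<le> ?a w" if "w \<in> A" for w using d(1) d(2)[OF that] by linarith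
    have nz: "?a w \<noteq> 0" "?b w \<noteq> 0" if "w \<in> A" for w using a[OF that] b[OF that] d(1) by linarith+
    have ia: "set_integrable lborel A (\<lambda>w. g w / ?a w ^ m)"
      and ib: "set_integrable lborel A (\<lambda>w. g w / ?b w ^ m)"
      and it: "set_integrable lborel A (\<lambda>w. real m * (g w * ?t w / ?a w ^ Suc m))"
      using A g nz by (auto intro!: set_integrable_compact continuous_intros simp del: power_Suc)
    have as_integral: "weighted_integral A g m ((u, c) + q) - weighted_integral A g m (u, c) + real m * ?D q
      = (LINT w:A|lborel. ?e w)"
      unfolding weighted_integral_def q'
      using set_integral_diff(2)[OF ib ia] set_integral_add(2)[OF set_integral_diff(1)[OF ib ia] it]
        set_integral_mult_right[of lborel A "real m" "\<lambda>w. g w * ?t w / ?a w ^ Suc m"]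
      by (simp only: prod.case add_Pair fst_conv snd_conv)
    have "\<bar>LINT w:A|lborel. ?e w\<bar> \<le> (LINT w:A|lborel. G * (C * (R + 1)\<^sup>2) * (norm q)\<^sup>2)"
      unfolding set_lebesgue_integral_def real_norm_def[symmetric]
    proof (rule Bochner_Integration.integral_norm_bound_integral)
      show "integrable lborel (\<lambda>w. indicator A w *\<^sub>R ?e w)"
        using set_integral_add(1)[OF set_integral_diff(1)[OF ib ia] it] unfolding set_integrable_def .
      show "integrable lborel (\<lambda>w. indicator A w *\<^sub>R (G * (C * (R + 1)\<^sup>2) * (norm q)\<^sup>2))"
        by (rule borel_integrable_compact[OF A]) (rule continuous_on_const)
      fix w show "norm (indicator A w *\<^sub>R ?e w) \<le> indicator A w *\<^sub>R (G * (C * (R + 1)\<^sup>2) * (norm q)\<^sup>2)"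
      proof (cases "w \<in> A")
        case True
        have ba: "?b w - ?a w = ?t w" by (simp add: inner_add_left)
        have distrib: "x / p - x / r + y * (x * z / v) = x * (1 / p - 1 / r + y * z / v)" for x y z p r v :: real
          by (simp add: right_diff_distrib distrib_left)
        have "?e w = g w * (1 / ?b w ^ m - 1 / ?a w ^ m + real m * (?b w - ?a w) / ?a w ^ Suc m)"
          unfolding ba by (rule distrib)
        then have "\<bar>?e w\<bar> = \<bar>g w\<bar> * \<bar>1 / ?b w ^ m - 1 / ?a w ^ m + real m * (?b w - ?a w) / ?a w ^ Suc m\<bar>"
          by (simp only: abs_mult)
        also have "\<dots> \<le> G * (C * (?b w - ?a w)\<^sup>2)"
          by (rule mult_mono[OF G(2)[OF True] C(2)[OF a[OF True] b[OF True]] less_imp_le[OF G(1)] abs_ge_zero])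
        also have "\<dots> \<le> G * (C * ((R + 1) * norm q)\<^sup>2)"
          unfolding ba
        proof (intro mult_left_mono)
          show "(?t w)\<^sup>2 \<le> ((R + 1) * norm q)\<^sup>2"
            using power_mono[OF t[OF True] abs_ge_zero, of 2] by simp
        qed (use G C in auto)
        finally show ?thesis using True by (simp add: power_mult_distrib)
      qed simp
    qed
    also have "\<dots> = B * (norm q)\<^sup>2"
    proof -
      have "(LINT w|lborel. indicator A w *\<^sub>R k) = measure lborel A * k" for k :: real
        using emeasure_compact_finite[OF A] borel_compact[OF A] by simp
      then show ?thesis by (simp only: set_lebesgue_integral_def B_def mult_ac)
    qed
    finally show ?thesis unfolding as_integral .
  qed
  have lin: "bounded_linear (\<lambda>q. - real m * ?D q)"
    using linear_weighted_integral[OF A g pos, of "Suc m"]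
    by (intro bounded_linear_const_mult) (simp add: linear_conv_bounded_linear)
  show ?thesis
    unfolding has_derivative_within_alt
  proof (intro conjI allI impI)
    fix e :: real assume e: "e > 0"
    define r where "r = min (d / (R + 1)) (e / (B + 1))"
    have "r > 0" using e d R B by (simp add: r_def)
    moreover have "norm (weighted_integral A g m y - weighted_integral A g m (u, c) - - real m * ?D (y - (u, c)))
        \<le> e * norm (y - (u, c))" if "norm (y - (u, c)) < r" for y
    proof -
      let ?q = "y - (u, c)"
      have "norm (weighted_integral A g m y - weighted_integral A g m (u, c) - - real m * ?D ?q) \<le> B * norm ?q * norm ?q"
        using remainder[of ?q] that by (simp add: r_def power2_eq_square mult.assoc)
      also have "\<dots> \<le> e * norm ?q"
      proof (rule mult_right_mono)
        have "norm ?q * (B + 1) < e" using that B by (simp add: r_def pos_less_divide_eq)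
        then have "B * norm ?q + norm ?q < e" by (simp add: algebra_simps)
        then show "B * norm ?q \<le> e" using norm_ge_zero[of ?q] by linarith
      qed simp
      finally show ?thesis .
    qed
    ultimately show "\<exists>r>0. \<forall>y\<in>UNIV. norm (y - (u, c)) < r \<longrightarrow>
      norm (weighted_integral A g m y - weighted_integral A g m (u, c) - - real m * ?D (y - (u, c)))
        \<le> e * norm (y - (u, c))" by blast
  qed (rule lin)
qed

section \<open>Polar bodies\<close>

text \<open>
  The bipolar theorem. A hyperplane strictly separating a point \<open>y\<close> from \<open>C\<close> does not pass through
  \<open>0 \<in> C\<close>, so it can be rescaled to an element of \<open>polar C\<close> on which \<open>y\<close> exceeds \<open>1\<close>.
\<close>
lemma polar_polar:
  fixes C :: "'a::euclidean_space set"
  assumes "convex C" "closed C" "0 \<in> C"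
  shows "polar (polar C) = C"
proof
  show "C \<subseteq> polar (polar C)" by (auto simp: polar_def inner_commute)
  show "polar (polar C) \<subseteq> C"
  proof (rule ccontr)
    assume "\<not> polar (polar C) \<subseteq> C"
    then obtain y where y: "y \<in> polar (polar C)" "y \<notin> C" by auto
    then obtain a b where ab: "a \<bullet> y < b" "\<And>x. x \<in> C \<Longrightarrow> b < a \<bullet> x"
      using separating_hyperplane_closed_point[OF assms(1,2)] by blast
    have b: "b < 0" using ab(2)[OF assms(3)] by simp
    have "a /\<^sub>R b \<in> polar C"
      unfolding polar_def
    proof clarify
      fix x assume "x \<in> C"
      then show "x \<bullet> (a /\<^sub>R b) \<le> 1"
        using ab(2)[of x] b by (simp add: inner_commute field_simps)
    qed
    then have "(a /\<^sub>R b) \<bullet> y \<le> 1" using y(1) unfolding polar_def by blast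
    then show False using ab(1) b by (simp add: field_simps)
  qed
qed

text \<open>
  A point \<open>y\<close> lies in the polar of \<open>\<xi> + polar C\<close> iff \<open>\<langle>l, y\<rangle> \<le> s\<close> for all \<open>l \<in> polar C\<close>, where
  \<open>s = 1 - \<langle>\<xi>, y\<rangle>\<close>. If \<open>s > 0\<close>, this says that \<open>k = y / s\<close> lies in the bipolar \<open>C\<close>, and then
  \<open>1 + \<langle>\<xi>, k\<rangle> = 1 / s\<close>. The choice \<open>l = 0\<close> rules out \<open>s < 0\<close>. If \<open>s = 0\<close>, the bipolar \<open>C\<close> would contain the whole ray through \<open>y\<close>, which
  compactness excludes.
\<close>
lemma polar_translate_polar:
  fixes C :: "'a::euclidean_space set"
  assumes conv: "convex C" and comp: "compact C" and zero: "0 \<in> C"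
    and pos: "\<And>k. k \<in> C \<Longrightarrow> 0 < 1 + \<xi> \<bullet> k"
  shows "polar ((+) \<xi> ` polar C) = (\<lambda>k. k /\<^sub>R (1 + \<xi> \<bullet> k)) ` C"
proof
  have bipolar: "polar (polar C) = C"
    using conv comp zero by (simp add: polar_polar compact_imp_closed)
  have mem: "y \<in> polar ((+) \<xi> ` polar C) \<longleftrightarrow> (\<forall>l\<in>polar C. l \<bullet> y \<le> 1 - \<xi> \<bullet> y)" for y
    by (auto simp: polar_def inner_add_left algebra_simps)
  show "polar ((+) \<xi> ` polar C) \<subseteq> (\<lambda>k. k /\<^sub>R (1 + \<xi> \<bullet> k)) ` C"
  proof
    fix y assume y: "y \<in> polar ((+) \<xi> ` polar C)"
    define s where "s = 1 - \<xi> \<bullet> y"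
    have le: "l \<bullet> y \<le> s" if "l \<in> polar C" for l using y that by (simp add: mem s_def)
    have "0 \<in> polar C" by (simp add: polar_def)
    then have "s \<ge> 0" using le[of 0] by simp
    moreover have "s \<noteq> 0"
    proof
      assume s: "s = 0"
      have "y \<noteq> 0" using s by (auto simp: s_def)
      have ray: "t *\<^sub>R y \<in> C" if "t \<ge> 0" for t
      proof -
        have "l \<bullet> (t *\<^sub>R y) \<le> 1" if "l \<in> polar C" for l
          using mult_nonneg_nonpos[OF \<open>t \<ge> 0\<close>, of "l \<bullet> y"] le[OF that] s by simp
        then have "t *\<^sub>R y \<in> polar (polar C)" by (auto simp: polar_def)
        then show ?thesis by (simp add: bipolar)
      qed
      obtain B where B: "\<And>k. k \<in> C \<Longrightarrow> norm k \<le> B"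
        using compact_imp_bounded[OF comp] by (auto simp: bounded_iff)
      have "B \<ge> 0" using B[OF zero] by simp
      then have "norm (((B + 1) / norm y) *\<^sub>R y) \<le> B" by (intro B ray) simp
      then show False using \<open>y \<noteq> 0\<close> \<open>B \<ge> 0\<close> by simp
    qed
    ultimately have s: "s > 0" by simp
    have "l \<bullet> (y /\<^sub>R s) \<le> 1" if "l \<in> polar C" for l
      using le[OF that] s by (simp add: field_simps)
    then have "y /\<^sub>R s \<in> polar (polar C)" by (auto simp: polar_def)
    then have "y /\<^sub>R s \<in> C" by (simp add: bipolar)
    moreover have "1 + \<xi> \<bullet> (y /\<^sub>R s) = 1 / s" using s by (simp add: s_def field_simps)
    then have "y = (y /\<^sub>R s) /\<^sub>R (1 + \<xi> \<bullet> (y /\<^sub>R s))" using s by simp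
    ultimately show "y \<in> (\<lambda>k. k /\<^sub>R (1 + \<xi> \<bullet> k)) ` C" by (rule rev_image_eqI)
  qed
  show "(\<lambda>k. k /\<^sub>R (1 + \<xi> \<bullet> k)) ` C \<subseteq> polar ((+) \<xi> ` polar C)"
  proof clarify
    fix k assume k: "k \<in> C"
    show "k /\<^sub>R (1 + \<xi> \<bullet> k) \<in> polar ((+) \<xi> ` polar C)"
      unfolding mem
    proof
      fix l assume "l \<in> polar C"
      then have "k \<bullet> l \<le> 1" using k by (auto simp: polar_def)
      then have "l \<bullet> k + \<xi> \<bullet> k \<le> 1 + \<xi> \<bullet> k" by (simp add: inner_commute)
      then have "(l \<bullet> k + \<xi> \<bullet> k) / (1 + \<xi> \<bullet> k) \<le> 1" using pos[OF k] by simp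
      then show "l \<bullet> (k /\<^sub>R (1 + \<xi> \<bullet> k)) \<le> 1 - \<xi> \<bullet> (k /\<^sub>R (1 + \<xi> \<bullet> k))"
        by (simp add: divide_inverse algebra_simps)
    qed
  qed
qed

lemma convex_polar: "convex (polar K)"
proof (rule convexI)
  fix y z and u v :: real
  assume *: "y \<in> polar K" "z \<in> polar K" "0 \<le> u" "0 \<le> v" "u + v = 1"
  show "u *\<^sub>R y + v *\<^sub>R z \<in> polar K"
    unfolding polar_def
  proof clarify
    fix x assume "x \<in> K"
    then have "u * (x \<bullet> y) \<le> u * 1" "v * (x \<bullet> z) \<le> v * 1"
      using * by (intro mult_left_mono; simp add: polar_def)+
    then show "x \<bullet> (u *\<^sub>R y + v *\<^sub>R z) \<le> 1" using * by (simp add: inner_add_right)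
  qed
qed

lemma zero_in_interior_polar:
  fixes K :: "'a::real_inner set"
  assumes "bounded K"
  shows "0 \<in> interior (polar K)"
proof -
  obtain R where R: "R > 0" "\<And>x. x \<in> K \<Longrightarrow> norm x \<le> R"
    using assms by (auto simp: bounded_pos)
  have "ball 0 (1 / R) \<subseteq> polar K"
  proof (clarsimp simp: polar_def)
    fix x y :: 'a assume "x \<in> K" "norm y < 1 / R"
    then have "norm x * norm y \<le> R * (1 / R)" using R by (intro mult_mono) auto
    then show "x \<bullet> y \<le> 1" using norm_cauchy_schwarz[of x y] R by simp
  qed
  moreover have "0 \<in> ball (0 :: 'a) (1 / R)" using R by simp
  ultimately show ?thesis by (meson interior_maximal open_ball subsetD)
qed

lemma compact_polar:
  fixes K :: "'a::euclidean_space set"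
  assumes "0 \<in> interior K"
  shows "compact (polar K)"
proof -
  have "polar K = (\<Inter>x\<in>K. {y. x \<bullet> y \<le> 1})" by (auto simp: polar_def)
  then have "closed (polar K)" by (auto intro!: closed_INT closed_halfspace_le)
  moreover have "bounded (polar K)"
  proof -
    obtain e where e: "e > 0" "cball 0 e \<subseteq> K" using assms by (auto simp: mem_interior_cball)
    have "norm y \<le> 1 / e" if y: "y \<in> polar K" for y
    proof (cases "y = 0")
      case False
      have "(e / norm y) *\<^sub>R y \<in> K" using e False by auto
      then have "((e / norm y) *\<^sub>R y) \<bullet> y \<le> 1" using y by (auto simp: polar_def)
      moreover have "((e / norm y) *\<^sub>R y) \<bullet> y = e * norm y"
        using False by (simp add: power2_norm_eq_inner[symmetric] power2_eq_square)
      ultimately show ?thesis using e by (simp add: field_simps)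
    qed (use e in simp)
    then show ?thesis by (auto simp: bounded_iff)
  qed
  ultimately show ?thesis by (simp add: compact_eq_bounded_closed)
qed

section \<open>The volume product near the origin\<close>

lemma dir_deriv_eq:
  assumes "(f has_derivative f') (at p)"
  shows "dir_deriv f v p = f' v"
proof -
  have "((\<lambda>t. p + t *\<^sub>R v) has_derivative (\<lambda>t. t *\<^sub>R v)) (at 0)"
    by (auto intro!: derivative_eq_intros)
  then have "((\<lambda>t. f (p + t *\<^sub>R v)) has_derivative (\<lambda>t. f' (t *\<^sub>R v))) (at 0)"
    by (rule has_derivative_compose) (use assms in simp)
  moreover have "(\<lambda>t. f' (t *\<^sub>R v)) = (*) (f' v)"
    using linear_cmul[OF has_derivative_linear[OF assms]] by (simp add: fun_eq_iff mult.commute)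
  ultimately show ?thesis
    unfolding dir_deriv_def by (simp add: DERIV_imp_deriv has_field_derivative_def)
qed

text \<open>
  Let \<open>M\<close> be the polar of \<open>\<xi> + polar K\<close>. The first factor of the volume product is the volume of the
  projective image \<open>M\<close> of \<open>K\<close>. For small \<open>\<xi>\<close> the body \<open>\<xi> + polar K\<close> still contains the origin, so it
  takes the role of \<open>C\<close> in \<open>polar_translate_polar\<close>: the polar of \<open>x + M\<close> is a projective image of
  \<open>\<xi> + polar K\<close>.
\<close>
lemma vp_shift_near_origin:
  fixes K :: "'a::euclidean_space set"
  assumes conv: "convex K" and comp: "compact K" and int: "0 \<in> interior K"
  obtains r where "r > 0"
    and "\<And>(p :: 'a \<times> 'a) k. norm p < r \<Longrightarrow> k \<in> K \<Longrightarrow> 0 < 1 + snd p \<bullet> k"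
    and "\<And>p w. norm p < r \<Longrightarrow> w \<in> polar K \<Longrightarrow> 0 < 1 + fst p \<bullet> snd p + fst p \<bullet> w"
    and "\<And>p. norm p < r \<Longrightarrow> vp_shift K p =
      weighted_integral K (\<lambda>_. 1) (Suc DIM('a)) (snd p, 0) *
      weighted_integral (polar K) (\<lambda>_. 1) (Suc DIM('a)) (fst p, fst p \<bullet> snd p)"
proof -
  let ?L = "polar K"
  have L: "convex ?L" "compact ?L" "0 \<in> interior ?L"
    using convex_polar compact_polar[OF int] zero_in_interior_polar[OF compact_imp_bounded[OF comp]] by auto
  obtain s where s: "s > 0" "ball 0 s \<subseteq> ?L" using L(3) by (auto simp: mem_interior)
  obtain R where R: "R > 0" "\<And>k. k \<in> K \<union> ?L \<Longrightarrow> norm k \<le> R"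
    using compact_imp_bounded[OF compact_Un[OF comp L(2)]] bounded_pos by metis
  \<comment> \<open>The bound \<open>R + 1\<close> covers both \<open>k \<in> K\<close> and \<open>\<xi> + w\<close> with \<open>w \<in> polar K\<close>; the bound \<open>s\<close> keeps \<open>- \<xi>\<close> in
    \<open>polar K\<close>.\<close>
  define r where "r = min s (min 1 (1 / (R + 1)))"
  have r: "r > 0" "r \<le> s" "r \<le> 1" "r \<le> 1 / (R + 1)" using s R by (simp_all add: r_def min_le_iff_disj)
  have rR: "r * (R + 1) \<le> 1" using r R by (simp add: pos_le_divide_eq)
  have small: "\<bar>x \<bullet> y\<bar> < 1" if "norm x < r" "norm y \<le> R + 1" for x y :: 'a
  proof -
    have "\<bar>x \<bullet> y\<bar> \<le> norm x * norm y" by (rule Cauchy_Schwarz_ineq2)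
    also have "\<dots> \<le> norm x * (R + 1)" using that by (intro mult_left_mono) auto
    also have "\<dots> < r * (R + 1)" using that R by (intro mult_strict_right_mono) auto
    finally show ?thesis using rR by simp
  qed
  have posK: "0 < 1 + \<xi> \<bullet> k" if "norm \<xi> < r" "k \<in> K" for \<xi> k
    using small[of \<xi> k] R(2)[of k] that by fastforce
  have posL: "0 < 1 + x \<bullet> \<xi> + x \<bullet> w" if "norm x < r" "norm \<xi> < r" "w \<in> ?L" for x \<xi> w
  proof -
    have "norm (\<xi> + w) \<le> R + 1"
      using norm_triangle_ineq[of \<xi> w] R(2)[of w] that r by fastforce
    then show ?thesis using small[of x "\<xi> + w"] that by (simp add: inner_add_right)
  qed
  have eq: "vp_shift K (x, \<xi>) = weighted_integral K (\<lambda>_. 1) (Suc DIM('a)) (\<xi>, 0) *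
      weighted_integral ?L (\<lambda>_. 1) (Suc DIM('a)) (x, x \<bullet> \<xi>)" if x: "norm x < r" and \<xi>: "norm \<xi> < r" for x \<xi>
  proof -
    let ?M = "polar ((+) \<xi> ` ?L)"
    have "0 \<in> K" using int interior_subset by blast
    then have M: "?M = (\<lambda>k. k /\<^sub>R (1 + \<xi> \<bullet> k)) ` K"
      using conv comp posK[OF \<xi>] by (intro polar_translate_polar)
    have "- \<xi> \<in> ?L" using s \<xi> r by auto
    then have "0 \<in> (+) \<xi> ` ?L" by (auto intro: image_eqI[of _ _ "- \<xi>"])
    moreover have "0 < 1 + x \<bullet> k" if "k \<in> (+) \<xi> ` ?L" for k
      using that posL[OF x \<xi>] by (auto simp: inner_add_right add.assoc)
    ultimately have P: "polar ((+) x ` ?M) = (\<lambda>k. k /\<^sub>R (1 + x \<bullet> k)) ` (+) \<xi> ` ?L"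
      using L by (intro polar_translate_polar) (auto intro: convex_translation compact_translation)
    have "measure lebesgue ((+) x ` ?M) = weighted_integral K (\<lambda>_. 1) (Suc DIM('a)) (\<xi>, 0)"
      unfolding measure_translation M using measure_projective_image[OF comp, of \<xi> 0] posK[OF \<xi>]
      by (simp add: image_image)
    moreover have "measure lebesgue (polar ((+) x ` ?M)) =
        weighted_integral ?L (\<lambda>_. 1) (Suc DIM('a)) (x, x \<bullet> \<xi>)"
      unfolding P using L(2) posL[OF x \<xi>] by (rule measure_projective_image)
    ultimately show ?thesis by (simp add: vp_shift_def vp_def)
  qed
  have fst_snd: "norm (fst p) < r" "norm (snd p) < r" if "norm p < r" for p :: "'a \<times> 'a"
    using that norm_fst_le[of "fst p" "snd p"] norm_snd_le[of "snd p" "fst p"] by auto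
  show ?thesis
  proof (rule that[OF r(1)])
    fix p :: "'a \<times> 'a" and k assume "norm p < r" "k \<in> K"
    then show "0 < 1 + snd p \<bullet> k" using posK fst_snd by simp
  next
    fix p :: "'a \<times> 'a" and w assume "norm p < r" "w \<in> ?L"
    then show "0 < 1 + fst p \<bullet> snd p + fst p \<bullet> w" using posL fst_snd by simp
  next
    fix p :: "'a \<times> 'a" assume "norm p < r"
    then show "vp_shift K p = weighted_integral K (\<lambda>_. 1) (Suc DIM('a)) (snd p, 0) *
      weighted_integral ?L (\<lambda>_. 1) (Suc DIM('a)) (fst p, fst p \<bullet> snd p)"
      using eq[of "fst p" "snd p"] fst_snd by simp
  qed
qed

lemma has_derivative_weighted_integral_snd:
  assumes "compact A" "continuous_on A g" "\<And>w. w \<in> A \<Longrightarrow> 0 < 1 + snd p \<bullet> w"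
  shows "((\<lambda>p. weighted_integral A g m (snd p, 0)) has_derivative
    (\<lambda>q. - real m * weighted_integral A (\<lambda>w. g w * (snd q \<bullet> w)) (Suc m) (snd p, 0))) (at p)"
proof -
  have "((\<lambda>p. (snd p, 0 :: real)) has_derivative (\<lambda>q. (snd q, 0))) (at p)"
    by (auto intro!: derivative_eq_intros)
  from has_derivative_compose[OF this has_derivative_weighted_integral[OF assms(1,2)]] show ?thesis
    using assms(3) by simp
qed

lemma has_derivative_weighted_integral_fst_inner:
  assumes "compact A" "continuous_on A g"
    and "\<And>w. w \<in> A \<Longrightarrow> 0 < 1 + fst p \<bullet> snd p + fst p \<bullet> w"
  shows "((\<lambda>p. weighted_integral A g m (fst p, fst p \<bullet> snd p)) has_derivative
    (\<lambda>q. - real m * weighted_integral A (\<lambda>w. g w * (fst q \<bullet> w + (fst p \<bullet> snd q + fst q \<bullet> snd p)))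
      (Suc m) (fst p, fst p \<bullet> snd p))) (at p)"
proof -
  have "((\<lambda>p. (fst p, fst p \<bullet> snd p)) has_derivative (\<lambda>q. (fst q, fst p \<bullet> snd q + fst q \<bullet> snd p))) (at p)"
    by (auto intro!: derivative_eq_intros)
  from has_derivative_compose[OF this has_derivative_weighted_integral[OF assms]] show ?thesis
    by simp
qed

lemma set_integral_one:
  fixes A :: "'a::euclidean_space set"
  assumes "compact A"
  shows "(LINT w:A|lborel. 1) = measure lborel A"
  using emeasure_compact_finite[OF assms] borel_compact[OF assms]
  by (simp add: set_lebesgue_integral_def)

lemma weighted_integral_zero:
  "weighted_integral A g m (0, 0) = (LINT w:A|lborel. g w)"
  by (simp add: weighted_integral_def)

text \<open>
  The derivative is needed on a whole neighbourhood of the origin, since it is differentiated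
  again. The derivative of the term \<open>\<langle>x, \<xi>\<rangle>\<close> has been pulled out of the integral, which leaves weights
  that do not depend on the base point.
\<close>
lemma has_derivative_weighted_product:
  fixes K :: "'a::euclidean_space set"
  assumes K: "compact K" and L: "compact L"
    and r: "norm p < r"
    and posK: "\<And>(p :: 'a \<times> 'a) k. norm p < r \<Longrightarrow> k \<in> K \<Longrightarrow> 0 < 1 + snd p \<bullet> k"
    and posL: "\<And>p w. norm p < r \<Longrightarrow> w \<in> L \<Longrightarrow> 0 < 1 + fst p \<bullet> snd p + fst p \<bullet> w"
    and F: "\<And>p. norm p < r \<Longrightarrow> F p = weighted_integral K (\<lambda>_. 1) n (snd p, 0) *
      weighted_integral L (\<lambda>_. 1) n (fst p, fst p \<bullet> snd p)"
  shows "(F has_derivative (\<lambda>b. - real n *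
     (weighted_integral K (\<lambda>k. snd b \<bullet> k) (Suc n) (snd p, 0) *
        weighted_integral L (\<lambda>_. 1) n (fst p, fst p \<bullet> snd p) +
      weighted_integral K (\<lambda>_. 1) n (snd p, 0) *
        (weighted_integral L (\<lambda>w. fst b \<bullet> w) (Suc n) (fst p, fst p \<bullet> snd p) +
         (fst p \<bullet> snd b + fst b \<bullet> snd p) * weighted_integral L (\<lambda>_. 1) (Suc n) (fst p, fst p \<bullet> snd p)))))
    (at p)"
proof -
  let ?c = "fst p \<bullet> snd p"
  let ?s = "\<lambda>b. fst p \<bullet> snd b + fst b \<bullet> snd p"
  have split: "weighted_integral L (\<lambda>w. fst b \<bullet> w + ?s b) (Suc n) (fst p, ?c) =
      weighted_integral L (\<lambda>w. fst b \<bullet> w) (Suc n) (fst p, ?c) +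
      ?s b * weighted_integral L (\<lambda>_. 1) (Suc n) (fst p, ?c)" for b
  proof -
    note lin = linear_weighted_integral[OF L continuous_on_const posL[OF r], of 1 "Suc n"]
    show ?thesis
      using linear_add[OF lin, of "(fst b, 0)" "(0, ?s b)"] linear_cmul[OF lin, of "?s b" "(0, 1)"] by simp
  qed
  have "((\<lambda>p. weighted_integral K (\<lambda>_. 1) n (snd p, 0) *
      weighted_integral L (\<lambda>_. 1) n (fst p, fst p \<bullet> snd p)) has_derivative (\<lambda>b. - real n *
     (weighted_integral K (\<lambda>k. snd b \<bullet> k) (Suc n) (snd p, 0) *
        weighted_integral L (\<lambda>_. 1) n (fst p, ?c) +
      weighted_integral K (\<lambda>_. 1) n (snd p, 0) *
        (weighted_integral L (\<lambda>w. fst b \<bullet> w) (Suc n) (fst p, ?c) +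
         ?s b * weighted_integral L (\<lambda>_. 1) (Suc n) (fst p, ?c))))) (at p)"
    by (rule has_derivative_eq_rhs[OF has_derivative_mult[OF
        has_derivative_weighted_integral_snd[OF K continuous_on_const posK[OF r]]
        has_derivative_weighted_integral_fst_inner[OF L continuous_on_const posL[OF r]]]])
      (assumption | rule ext, unfold mult_1_left split, simp add: algebra_simps)+
  moreover have "\<forall>\<^sub>F q in at p. weighted_integral K (\<lambda>_. 1) n (snd q, 0) *
      weighted_integral L (\<lambda>_. 1) n (fst q, fst q \<bullet> snd q) = F q"
  proof -
    have "\<forall>\<^sub>F q in at p. q \<in> ball 0 r" using r by (intro eventually_at_in_open') auto
    then show ?thesis by eventually_elim (simp add: F)
  qed
  ultimately show ?thesis
    by (rule has_derivative_transform_eventually) (simp_all add: F r)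
qed

text \<open>
  Since the first moments vanish, the products of two first derivatives drop out of the second
  derivative.
\<close>
lemma second_dir_deriv_weighted_product:
  fixes K :: "'a::euclidean_space set"
  assumes K: "compact K" and L: "compact L" and r: "r > 0"
    and posK: "\<And>(p :: 'a \<times> 'a) k. norm p < r \<Longrightarrow> k \<in> K \<Longrightarrow> 0 < 1 + snd p \<bullet> k"
    and posL: "\<And>p w. norm p < r \<Longrightarrow> w \<in> L \<Longrightarrow> 0 < 1 + fst p \<bullet> snd p + fst p \<bullet> w"
    and F: "\<And>p. norm p < r \<Longrightarrow> F p = weighted_integral K (\<lambda>_. 1) n (snd p, 0) *
      weighted_integral L (\<lambda>_. 1) n (fst p, fst p \<bullet> snd p)"
    and K0: "(LINT k:K|lborel. snd b \<bullet> k) = 0" and L0: "(LINT w:L|lborel. fst b \<bullet> w) = 0"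
  shows "dir_deriv (dir_deriv F b) a 0 = real n *
      (real (Suc n) * ((LINT k:K|lborel. (snd a \<bullet> k) * (snd b \<bullet> k)) * measure lborel L +
        measure lborel K * (LINT w:L|lborel. (fst a \<bullet> w) * (fst b \<bullet> w)))
       - (fst a \<bullet> snd b + fst b \<bullet> snd a) * (measure lborel K * measure lborel L))"
proof -
  let ?wK = "\<lambda>g m (p :: 'a \<times> 'a). weighted_integral K g m (snd p, 0)"
  let ?wL = "\<lambda>g m (p :: 'a \<times> 'a). weighted_integral L g m (fst p, fst p \<bullet> snd p)"
  let ?F' = "\<lambda>p. - real n * (?wK (\<lambda>k. snd b \<bullet> k) (Suc n) p * ?wL (\<lambda>_. 1) n p +
      ?wK (\<lambda>_. 1) n p * (?wL (\<lambda>w. fst b \<bullet> w) (Suc n) p +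
        (fst p \<bullet> snd b + fst b \<bullet> snd p) * ?wL (\<lambda>_. 1) (Suc n) p))"
  let ?I = "\<lambda>A g. LINT w:A|lborel. g w"
  have n0: "norm (0 :: 'a \<times> 'a) < r" using r by simp
  have dK: "(?wK g m has_derivative (\<lambda>q. - real m * ?I K (\<lambda>k. g k * (snd q \<bullet> k)))) (at 0)"
    if "continuous_on K g" for g m
    using has_derivative_weighted_integral_snd[OF K that posK[OF n0], of m] by (simp add: weighted_integral_zero)
  have dL: "(?wL g m has_derivative (\<lambda>q. - real m * ?I L (\<lambda>w. g w * (fst q \<bullet> w)))) (at 0)"
    if "continuous_on L g" for g m
    using has_derivative_weighted_integral_fst_inner[OF L that posL[OF n0], of m] by (simp add: weighted_integral_zero)
  have ds: "((\<lambda>p. fst p \<bullet> snd b + fst b \<bullet> snd p) has_derivative (\<lambda>q. fst q \<bullet> snd b + fst b \<bullet> snd q)) (at 0)"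
    by (auto intro!: derivative_eq_intros)
  have cont: "continuous_on A (\<lambda>w. v \<bullet> w)" for A and v :: 'a by (intro continuous_intros)
  have F': "(?F' has_derivative (\<lambda>q. - real n *
      ((- real (Suc n) * ?I K (\<lambda>k. (snd b \<bullet> k) * (snd q \<bullet> k))) * measure lborel L +
       measure lborel K * (- real (Suc n) * ?I L (\<lambda>w. (fst b \<bullet> w) * (fst q \<bullet> w)) +
         (fst q \<bullet> snd b + fst b \<bullet> snd q) * measure lborel L)))) (at 0)"
    by (rule has_derivative_eq_rhs[OF has_derivative_mult_right[OF has_derivative_add[OF
        has_derivative_mult[OF dK[OF cont] dL[OF continuous_on_const]]
        has_derivative_mult[OF dK[OF continuous_on_const] has_derivative_add[OF dL[OF cont]
          has_derivative_mult[OF ds dL[OF continuous_on_const]]]]]]])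
      (simp add: fun_eq_iff weighted_integral_zero K0 L0 set_integral_one K L algebra_simps)
  have "(dir_deriv F b has_derivative (\<lambda>q. - real n *
      ((- real (Suc n) * ?I K (\<lambda>k. (snd b \<bullet> k) * (snd q \<bullet> k))) * measure lborel L +
       measure lborel K * (- real (Suc n) * ?I L (\<lambda>w. (fst b \<bullet> w) * (fst q \<bullet> w)) +
         (fst q \<bullet> snd b + fst b \<bullet> snd q) * measure lborel L)))) (at 0)"
  proof (rule has_derivative_transform_within[OF F' r])
    fix p :: "'a \<times> 'a" assume "dist p 0 < r"
    then have "norm p < r" by simp
    from dir_deriv_eq[OF has_derivative_weighted_product[OF K L this posK posL F], of b]
    show "?F' p = dir_deriv F b p" by simp
  qed simp
  from dir_deriv_eq[OF this, of a] show ?thesis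
    by (simp add: mult.commute algebra_simps)
qed

section \<open>Covariance matrices\<close>

lemma measure_lebesgue_compact:
  fixes A :: "'a::euclidean_space set"
  assumes "compact A"
  shows "measure lebesgue A = measure lborel A"
  using borel_compact[OF assms] by (intro measure_completion) simp

lemma measure_pos_of_interior:
  fixes A :: "'a::euclidean_space set"
  assumes "compact A" "interior A \<noteq> {}"
  shows "measure lborel A > 0"
proof -
  have "\<not> negligible A"
    using assms(2) open_not_negligible[OF open_interior] negligible_subset[OF _ interior_subset] by blast
  then have "measure lebesgue A \<noteq> 0"
    using lmeasurable_compact[OF assms(1)] by (simp add: negligible_iff_measure)
  then show ?thesis
    using measure_nonneg[of lborel A] by (simp add: less_le measure_lebesgue_compact[OF assms(1)])
qed

lemma set_integral_lebesgue_lborel: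
  fixes f :: "'a::euclidean_space \<Rightarrow> real"
  assumes "compact A" "continuous_on A f"
  shows "(LINT x:A|lebesgue. f x) = (LINT x:A|lborel. f x)"
  unfolding set_lebesgue_integral_def
  by (intro integral_completion borel_measurable_integrable borel_integrable_compact assms)

lemma cov_nth:
  assumes "compact A"
  shows "cov A $ i $ j = (LINT x:A|lborel. x $ i * x $ j) / measure lborel A"
  unfolding cov_def measure_lebesgue_compact[OF assms]
  by (simp add: set_integral_lebesgue_lborel[OF assms] continuous_intros)

lemma transpose_cov: "transpose (cov A) = cov A"
  by (simp add: cov_def transpose_def mult.commute)

lemma inner_cov:
  fixes A :: "(real^'n) set"
  assumes A: "compact A"
  shows "u \<bullet> (cov A *v v) = (LINT x:A|lborel. (u \<bullet> x) * (v \<bullet> x)) / measure lborel A"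
proof -
  have int: "integrable lborel (\<lambda>x. indicator A x *\<^sub>R (u $ i * v $ j * (x $ i * x $ j)))" for i j
    using A by (intro borel_integrable_compact continuous_intros)
  have "(u \<bullet> x) * (v \<bullet> x) = (\<Sum>i\<in>UNIV. \<Sum>j\<in>UNIV. u $ i * v $ j * (x $ i * x $ j))" for x
    by (simp add: inner_vec_def sum_product mult_ac)
  then have "(LINT x:A|lborel. (u \<bullet> x) * (v \<bullet> x)) =
      (LINT x|lborel. (\<Sum>i\<in>UNIV. \<Sum>j\<in>UNIV. indicator A x *\<^sub>R (u $ i * v $ j * (x $ i * x $ j))))"
    by (simp add: set_lebesgue_integral_def sum_distrib_left)
  also have "\<dots> = (\<Sum>i\<in>UNIV. \<Sum>j\<in>UNIV. LINT x:A|lborel. u $ i * v $ j * (x $ i * x $ j))"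
    unfolding set_lebesgue_integral_def using int
    by (subst Bochner_Integration.integral_sum; (intro Bochner_Integration.integrable_sum int)?)
      (intro sum.cong refl Bochner_Integration.integral_sum int)
  also have "\<dots> = (\<Sum>i\<in>UNIV. \<Sum>j\<in>UNIV. u $ i * v $ j * (LINT x:A|lborel. x $ i * x $ j))"
    by simp
  finally show ?thesis
    by (simp add: cov_nth[OF A] inner_vec_def matrix_vector_mult_def sum_distrib_left
        sum_divide_distrib mult_ac)
qed

lemma psd_cov:
  assumes "compact A"
  shows "psd (cov A)"
proof -
  have "0 \<le> (LINT x:A|lborel. (v \<bullet> x) * (v \<bullet> x))" for v
    unfolding set_lebesgue_integral_def by (intro Bochner_Integration.integral_nonneg) auto
  then show ?thesis by (simp add: psd_def transpose_cov inner_cov[OF assms])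
qed

text \<open>
  A kernel vector \<open>v\<close> would satisfy \<open>\<integral>\<^bsub>A\<^esub> \<langle>v, x\<rangle>\<^sup>2 dx = 0\<close>, so that up to a null set \<open>A\<close> would lie in the
  hyperplane orthogonal to \<open>v\<close>.
\<close>
lemma invertible_cov:
  fixes A :: "(real^'n) set"
  assumes A: "compact A" and int: "interior A \<noteq> {}"
  shows "invertible (cov A)"
proof -
  have pos: "measure lborel A > 0" using A int by (rule measure_pos_of_interior)
  have "v = 0" if v: "cov A *v v = 0" for v
  proof (rule ccontr)
    assume "v \<noteq> 0"
    let ?f = "\<lambda>x. indicator A x *\<^sub>R ((v \<bullet> x) * (v \<bullet> x))"
    have "(LINT x|lborel. ?f x) = 0"
      using inner_cov[OF A, of v v] v pos by (simp add: set_lebesgue_integral_def)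
    moreover have "integrable lborel ?f"
      using A by (intro borel_integrable_compact continuous_intros)
    ultimately have "AE x in lborel. ?f x = 0"
      by (subst (asm) integral_nonneg_eq_0_iff_AE) auto
    moreover have "AE x in lborel. v \<bullet> x \<noteq> 0"
    proof -
      have "negligible {x. v \<bullet> x = 0}" using \<open>v \<noteq> 0\<close> by (intro negligible_hyperplane) simp
      then have "emeasure lebesgue {x. v \<bullet> x = 0} = 0"
        by (simp add: negligible_iff_null_sets null_sets_def)
      moreover have "{x. v \<bullet> x = 0} \<in> sets borel" by (intro borel_closed closed_hyperplane)
      ultimately have "{x. v \<bullet> x = 0} \<in> null_sets lborel" by (simp add: null_sets_def)
      then show ?thesis by (rule AE_I') auto
    qed
    ultimately have "AE x in lborel. x \<notin> A" by eventually_elim (auto simp: indicator_def split: if_splits)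
    then have "emeasure lborel {x \<in> space lborel. x \<in> A} = 0" by (rule emeasure_eq_0_AE)
    then show False using pos by (simp add: measure_def)
  qed
  then show ?thesis
    using matrix_left_invertible_ker[of "cov A"] invertible_left_inverse[of "cov A"] by blast
qed

section \<open>The Hessian\<close>

lemma hessian_vp_shift:
  fixes K :: "(real^'n) set"
  assumes conv: "convex K" and comp: "compact K" and int: "0 \<in> interior K"
    and crit: "critical_point (vp_shift K) (0, 0)"
  shows "hessian (vp_shift K) (0, 0) = ((real CARD('n) + 1) * vp K) *\<^sub>R
    block_matrix ((real CARD('n) + 2) *\<^sub>R cov (polar K)) (- mat 1) (- mat 1)
      ((real CARD('n) + 2) *\<^sub>R cov K)"
proof -
  let ?L = "polar K" and ?n = "Suc CARD('n)" and ?F = "vp_shift K"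
  have L: "compact ?L" "0 \<in> interior ?L"
    using compact_polar[OF int] zero_in_interior_polar[OF compact_imp_bounded[OF comp]] by auto
  have posK: "measure lborel K > 0" and posL: "measure lborel ?L > 0"
    using measure_pos_of_interior comp int L by blast+
  obtain r where r: "r > 0"
    and rK: "\<And>(p :: (real^'n) \<times> (real^'n)) k. norm p < r \<Longrightarrow> k \<in> K \<Longrightarrow> 0 < 1 + snd p \<bullet> k"
    and rL: "\<And>p w. norm p < r \<Longrightarrow> w \<in> polar K \<Longrightarrow> 0 < 1 + fst p \<bullet> snd p + fst p \<bullet> w"
    and F: "\<And>p. norm p < r \<Longrightarrow> ?F p =
      weighted_integral K (\<lambda>_. 1) ?n (snd p, 0) * weighted_integral ?L (\<lambda>_. 1) ?n (fst p, fst p \<bullet> snd p)"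
    using vp_shift_near_origin[OF conv comp int] by (simp only: DIM_cart DIM_real mult_1_right) blast
  have n0: "norm (0 :: (real^'n) \<times> (real^'n)) < r" using r by simp
  \<comment> \<open>The first derivative of the product formula at the origin vanishes. Testing it with vectors
    \<open>(0, v)\<close> and \<open>(v, 0)\<close> separates the two first moments.\<close>
  have barycenters: "(LINT k:K|lborel. snd b \<bullet> k) * measure lborel ?L
      + measure lborel K * (LINT w:?L|lborel. fst b \<bullet> w) = 0" for b
  proof -
    have "dir_deriv ?F b 0 = 0"
      using crit by (intro dir_deriv_eq) (simp add: critical_point_def zero_prod_def)
    then show ?thesis
      using dir_deriv_eq[OF has_derivative_weighted_product[OF comp L(1) n0 rK rL F], of b]
      by (simp add: weighted_integral_zero set_integral_one comp L(1) add_eq_0_iff2)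
  qed
  have K0: "(LINT k:K|lborel. v \<bullet> k) = 0" for v
    using barycenters[of "(0, v)"] posL by simp
  have L0: "(LINT w:?L|lborel. v \<bullet> w) = 0" for v
    using barycenters[of "(v, 0)"] posK by simp
  have vp: "vp K = measure lborel K * measure lborel ?L"
    by (simp add: vp_def measure_lebesgue_compact comp L(1))
  have entry: "hessian ?F (0, 0) $ a $ b = real ?n * vp K *
      (real (Suc ?n) * (fst (basis2 a) \<bullet> (cov ?L *v fst (basis2 b)) + snd (basis2 a) \<bullet> (cov K *v snd (basis2 b)))
       - (fst (basis2 a) \<bullet> snd (basis2 b) + fst (basis2 b) \<bullet> snd (basis2 a)))" for a b
  proof -
    have "hessian ?F (0, 0) $ a $ b = dir_deriv (dir_deriv ?F (basis2 b)) (basis2 a) 0"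
      by (simp add: hessian_def zero_prod_def)
    also have "\<dots> = real ?n *
      (real (Suc ?n) * ((LINT k:K|lborel. (snd (basis2 a) \<bullet> k) * (snd (basis2 b) \<bullet> k)) * measure lborel ?L +
        measure lborel K * (LINT w:?L|lborel. (fst (basis2 a) \<bullet> w) * (fst (basis2 b) \<bullet> w)))
       - (fst (basis2 a) \<bullet> snd (basis2 b) + fst (basis2 b) \<bullet> snd (basis2 a)) * (measure lborel K * measure lborel ?L))"
      by (rule second_dir_deriv_weighted_product[OF comp L(1) r rK rL F K0 L0])
    also have "\<dots> = real ?n * vp K *
      (real (Suc ?n) * (fst (basis2 a) \<bullet> (cov ?L *v fst (basis2 b)) + snd (basis2 a) \<bullet> (cov K *v snd (basis2 b)))
       - (fst (basis2 a) \<bullet> snd (basis2 b) + fst (basis2 b) \<bullet> snd (basis2 a)))"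
      unfolding inner_cov[OF comp] inner_cov[OF L(1)] vp using posK posL by (simp add: field_simps)
    finally show ?thesis .
  qed
  have cov_axis: "axis i 1 \<bullet> (M *v axis j 1) = M $ i $ j" for M :: "real^'n^'n" and i j
    by (simp add: inner_axis' matrix_vector_mul_component inner_axis)
  show ?thesis
    by (simp add: vec_eq_iff block_matrix_def entry cov_axis inner_axis_axis mat_def split: sum.split)
      (simp add: algebra_simps)
qed

lemma det_scaleR:
  fixes M :: "real^'n^'n"
  shows "det (c *\<^sub>R M) = c ^ CARD('n) * det M"
  by (simp add: det_def prod.distrib sum_distrib_left mult_ac)

lemma matrix_inv_scaleR:
  fixes M :: "real^'n^'n"
  assumes "invertible M" "c \<noteq> 0"
  shows "matrix_inv (c *\<^sub>R M) = (1 / c) *\<^sub>R matrix_inv M"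
  using assms by (intro matrix_inv_unique)
    (simp_all add: scalar_matrix_assoc[symmetric] matrix_scalar_ac matrix_inv_inverse)

theorem proposition2p3:
  fixes K :: "(real ^ 'n) set"
  assumes "convex K" and "compact K" and "0 \<in> interior K"
    and "critical_point (vp_shift K) (0, 0)"
  shows "(hessian (vp_shift K) (0, 0) \<succeq> 0 \<longleftrightarrow>
           cov (polar K) \<succeq> (1 / (real CARD('n) + 2)\<^sup>2) *\<^sub>R matrix_inv (cov K)) \<and>
         det (hessian (vp_shift K) (0, 0)) =
           (real CARD('n) + 1) ^ (2 * CARD('n)) * vp K ^ (2 * CARD('n)) *
           det ((real CARD('n) + 2)\<^sup>2 *\<^sub>R (cov (polar K) ** cov K) - mat 1)"
proof -
  let ?L = "polar K"
  define m where "m = real CARD('n) + 2"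
  have m: "m > 0" by (simp add: m_def)
  define c where "c = (real CARD('n) + 1) * vp K"
  let ?H = "hessian (vp_shift K) (0, 0)"
  let ?M = "block_matrix (m *\<^sub>R cov ?L) (- mat 1) (- mat 1) (m *\<^sub>R cov K)"
  have H: "?H = c *\<^sub>R ?M"
    unfolding c_def m_def using assms by (rule hessian_vp_shift)
  have L: "compact ?L" "0 \<in> interior ?L"
    using compact_polar[OF assms(3)] zero_in_interior_polar[OF compact_imp_bounded[OF assms(2)]] by auto
  have "measure lebesgue A > 0" if "compact A" "0 \<in> interior A" for A :: "(real^'n) set"
    using measure_pos_of_interior[of A] that by (auto simp: measure_lebesgue_compact)
  then have "vp K > 0" unfolding vp_def using assms L by simp
  then have c: "c > 0" by (simp add: c_def)
  have inv: "invertible (cov K)" using assms by (intro invertible_cov) auto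
  then have inv': "invertible (m *\<^sub>R cov K)" using m by (intro scalar_invertible) auto
  have psdK: "psd (m *\<^sub>R cov K)" using m psd_cov[OF assms(2)] by (simp add: psd_scaleR_iff)
  have schur: "m *\<^sub>R cov ?L - matrix_inv (m *\<^sub>R cov K) = m *\<^sub>R (cov ?L - (1 / m\<^sup>2) *\<^sub>R matrix_inv (cov K))"
    using m inv by (simp add: matrix_inv_scaleR scaleR_right_diff_distrib power2_eq_square)
  have "?H \<succeq> 0 \<longleftrightarrow> psd ?M"
    using c by (simp add: loewner_ge_def H psd_scaleR_iff)
  also have "\<dots> \<longleftrightarrow> psd (m *\<^sub>R cov ?L - matrix_inv (m *\<^sub>R cov K))"
    by (rule psd_block_minus_mat_iff[OF psdK inv'])
  also have "\<dots> \<longleftrightarrow> cov ?L \<succeq> (1 / m\<^sup>2) *\<^sub>R matrix_inv (cov K)"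
    using m by (simp add: schur psd_scaleR_iff loewner_ge_def)
  finally have psd_iff: "?H \<succeq> 0 \<longleftrightarrow> cov ?L \<succeq> (1 / m\<^sup>2) *\<^sub>R matrix_inv (cov K)" .
  have "det ?M = det ((m *\<^sub>R cov ?L) ** (m *\<^sub>R cov K) - mat 1)"
    by (rule det_block_minus_mat[OF inv'])
  also have "(m *\<^sub>R cov ?L) ** (m *\<^sub>R cov K) = m\<^sup>2 *\<^sub>R (cov ?L ** cov K)"
    by (simp add: scalar_matrix_assoc[symmetric] matrix_scalar_ac power2_eq_square)
  finally have "det ?H = c ^ (2 * CARD('n)) * det (m\<^sup>2 *\<^sub>R (cov ?L ** cov K) - mat 1)"
    by (simp add: H det_scaleR mult_2)
  then show ?thesis
    using psd_iff by (simp add: c_def m_def power_mult_distrib)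
qed

end
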